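(* Let $F$ be the strong dual of a strict $(LF)$-space $E$, i.e. $F=(E',\beta(E',E))$. Then $F$ has countable fan tightness if and only if $F$ is metrizable.
   Context: A strict $(LF)$-space is a locally convex space that is the strict inductive limit of a sequence $\{E_n\}_{n\in\mathbb{N}}$ of Fréchet spaces (each $E_n$ is a topological linear subspace of $E_{n+1}$). $\beta(E',E)$ is the strong topology on the topological dual $E'$. A topological space $X$ has countable fan tightness if for each $x\in X$ and all sets $A_n\subset X$, $n\in\mathbb{N}$, with $x\in\bigcap_{n\in\mathbb{N}}\overline{A_n}$ there are finite sets $F_n\subset A_n$, $n\in\mathbb{N}$, such that $x\in\overline{\bigcup_{n\in\mathbb{N}}F_n}$. *)

theory Defs
  imports "HOL-Analysis.Analysis"
begin

(* A topological vector space is given by a scalar multiplication s on an additive group and a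
   topology T; its carrier is topspace T, a linear subspace of the ambient type.  The scalar field
   is a real_normed_field; since the norm of such a field is multiplicative, it is the field of
   real or of complex numbers (Gelfand-Mazur), so both cases are covered at once. *)

definition topological_vector_space ::
  "('k::real_normed_field \<Rightarrow> 'a::ab_group_add \<Rightarrow> 'a) \<Rightarrow> 'a topology \<Rightarrow> bool" where
  "topological_vector_space s T \<longleftrightarrow>
     vector_space s \<and> module.subspace s (topspace T) \<and>
     continuous_map (prod_topology T T) T (\<lambda>(x, y). x + y) \<and>
     continuous_map (prod_topology euclidean T) T (\<lambda>(c, x). s c x)"

definition convex_wrt ::
  "('k::real_normed_field \<Rightarrow> 'a::ab_group_add \<Rightarrow> 'a) \<Rightarrow> 'a set \<Rightarrow> bool" where
  "convex_wrt s C \<longleftrightarrow>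
     (\<forall>x\<in>C. \<forall>y\<in>C. \<forall>u\<ge>0. \<forall>v\<ge>0. u + v = 1 \<longrightarrow> s (of_real u) x + s (of_real v) y \<in> C)"

definition locally_convex_space ::
  "('k::real_normed_field \<Rightarrow> 'a::ab_group_add \<Rightarrow> 'a) \<Rightarrow> 'a topology \<Rightarrow> bool" where
  "locally_convex_space s T \<longleftrightarrow>
     topological_vector_space s T \<and>
     (\<forall>U. openin T U \<and> 0 \<in> U \<longrightarrow>
       (\<exists>V C. openin T V \<and> 0 \<in> V \<and> V \<subseteq> C \<and> C \<subseteq> U \<and> convex_wrt s C))"

definition frechet_space ::
  "('k::real_normed_field \<Rightarrow> 'a::ab_group_add \<Rightarrow> 'a) \<Rightarrow> 'a topology \<Rightarrow> bool" where
  "frechet_space s T \<longleftrightarrow>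
     locally_convex_space s T \<and>
     (\<exists>d. Metric_space (topspace T) d \<and>
          Metric_space.mtopology (topspace T) d = T \<and>
          Metric_space.mcomplete (topspace T) d \<and>
          (\<forall>x\<in>topspace T. \<forall>y\<in>topspace T. \<forall>z\<in>topspace T. d (x + z) (y + z) = d x y))"

(* The inductive limit topology is the finest locally convex topology on the union of the steps
   that makes all inclusions continuous.  The steps need not be strictly increasing. *)

definition strict_inductive_limit ::
  "('k::real_normed_field \<Rightarrow> 'a::ab_group_add \<Rightarrow> 'a) \<Rightarrow> (nat \<Rightarrow> 'a topology) \<Rightarrow> 'a topology \<Rightarrow> bool" where
  "strict_inductive_limit s E T \<longleftrightarrow>
     (\<forall>n. locally_convex_space s (E n)) \<and>
     (\<forall>n. topspace (E n) \<subseteq> topspace (E (Suc n)) \<and>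
          E n = subtopology (E (Suc n)) (topspace (E n))) \<and>
     locally_convex_space s T \<and>
     topspace T = (\<Union>n. topspace (E n)) \<and>
     (\<forall>n. continuous_map (E n) T id) \<and>
     (\<forall>T'. locally_convex_space s T' \<and> topspace T' = topspace T \<and>
           (\<forall>n. continuous_map (E n) T' id) \<longrightarrow> continuous_map T T' id)"

definition strict_LF_space ::
  "('k::real_normed_field \<Rightarrow> 'a::ab_group_add \<Rightarrow> 'a) \<Rightarrow> 'a topology \<Rightarrow> bool" where
  "strict_LF_space s T \<longleftrightarrow>
     (\<exists>E. (\<forall>n. frechet_space s (E n)) \<and> strict_inductive_limit s E T)"

definition tvs_bounded ::
  "('k::real_normed_field \<Rightarrow> 'a::ab_group_add \<Rightarrow> 'a) \<Rightarrow> 'a topology \<Rightarrow> 'a set \<Rightarrow> bool" where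
  "tvs_bounded s T B \<longleftrightarrow>
     B \<subseteq> topspace T \<and>
     (\<forall>U. openin T U \<and> 0 \<in> U \<longrightarrow> (\<exists>r>0. \<forall>c. norm c \<ge> r \<longrightarrow> B \<subseteq> s c ` U))"

(* Functionals live on topspace T only; extensional fixes their values elsewhere, so that distinct
   elements of the set below are distinct as functionals. *)

definition topological_dual ::
  "('k::real_normed_field \<Rightarrow> 'a::ab_group_add \<Rightarrow> 'a) \<Rightarrow> 'a topology \<Rightarrow> ('a \<Rightarrow> 'k) set" where
  "topological_dual s T =
     {f \<in> extensional (topspace T).
        (\<forall>x\<in>topspace T. \<forall>y\<in>topspace T. f (x + y) = f x + f y) \<and>
        (\<forall>c. \<forall>x\<in>topspace T. f (s c x) = c * f x) \<and>
        continuous_map T euclidean f}"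

(* The topology of uniform convergence on the bounded subsets of T. *)

definition strong_dual ::
  "('k::real_normed_field \<Rightarrow> 'a::ab_group_add \<Rightarrow> 'a) \<Rightarrow> 'a topology \<Rightarrow> ('a \<Rightarrow> 'k) topology" where
  "strong_dual s T = topology (\<lambda>W. W \<subseteq> topological_dual s T \<and>
     (\<forall>f\<in>W. \<exists>B e. tvs_bounded s T B \<and> e > 0 \<and>
        {g \<in> topological_dual s T. \<forall>x\<in>B. norm (g x - f x) \<le> e} \<subseteq> W))"

lemma tvs_bounded_empty: "tvs_bounded s T {}"
  by (auto simp: tvs_bounded_def intro: exI[of _ 1])

lemma tvs_bounded_Un:
  assumes "tvs_bounded s T A" "tvs_bounded s T B"
  shows "tvs_bounded s T (A \<union> B)"
  unfolding tvs_bounded_def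
proof (intro conjI allI impI)
  show "A \<union> B \<subseteq> topspace T"
    using assms by (auto simp: tvs_bounded_def)
next
  fix U assume U: "openin T U \<and> 0 \<in> U"
  obtain p where p: "p > 0" "\<And>c. norm c \<ge> p \<Longrightarrow> A \<subseteq> s c ` U"
    using assms(1) U unfolding tvs_bounded_def by blast
  obtain q where q: "q > 0" "\<And>c. norm c \<ge> q \<Longrightarrow> B \<subseteq> s c ` U"
    using assms(2) U unfolding tvs_bounded_def by blast
  show "\<exists>r>0. \<forall>c. norm c \<ge> r \<longrightarrow> A \<union> B \<subseteq> s c ` U"
    using p q by (intro exI[of _ "max p q"]) auto
qed

lemma openin_strong_dual:
  "openin (strong_dual s T) W \<longleftrightarrow> W \<subseteq> topological_dual s T \<and>
     (\<forall>f\<in>W. \<exists>B e. tvs_bounded s T B \<and> e > 0 \<and>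
        {g \<in> topological_dual s T. \<forall>x\<in>B. norm (g x - f x) \<le> e} \<subseteq> W)"
proof -
  let ?N = "\<lambda>f B e. {g \<in> topological_dual s T. \<forall>x\<in>B. norm (g x - f x) \<le> e}"
  let ?P = "\<lambda>W. W \<subseteq> topological_dual s T \<and>
    (\<forall>f\<in>W. \<exists>B e. tvs_bounded s T B \<and> e > 0 \<and> ?N f B e \<subseteq> W)"
  have "?P (V \<inter> W)" if V: "?P V" and W: "?P W" for V W
  proof (intro conjI ballI)
    show "V \<inter> W \<subseteq> topological_dual s T"
      using V by blast
  next
    fix f assume f: "f \<in> V \<inter> W"
    obtain A p where A: "tvs_bounded s T A" "p > 0" "?N f A p \<subseteq> V"
      using V f by blast
    obtain B q where B: "tvs_bounded s T B" "q > 0" "?N f B q \<subseteq> W"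
      using W f by blast
    have "?N f (A \<union> B) (min p q) \<subseteq> ?N f A p \<inter> ?N f B q"
      by auto
    then have "?N f (A \<union> B) (min p q) \<subseteq> V \<inter> W"
      using A(3) B(3) by blast
    moreover have "min p q > 0"
      using A(2) B(2) by simp
    ultimately show "\<exists>B e. tvs_bounded s T B \<and> e > 0 \<and> ?N f B e \<subseteq> V \<inter> W"
      using tvs_bounded_Un[OF A(1) B(1)] by blast
  qed
  moreover have "?P (\<Union>K)" if K: "\<forall>W\<in>K. ?P W" for K
  proof (intro conjI ballI)
    show "\<Union>K \<subseteq> topological_dual s T"
      using K by blast
  next
    fix f assume "f \<in> \<Union>K"
    then obtain W where W: "W \<in> K" "f \<in> W" by blast
    then obtain B e where "tvs_bounded s T B" "e > 0" "?N f B e \<subseteq> W"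
      using K by blast
    then show "\<exists>B e. tvs_bounded s T B \<and> e > 0 \<and> ?N f B e \<subseteq> \<Union>K"
      using W(1) by blast
  qed
  ultimately have "istopology ?P"
    unfolding istopology_def by blast
  then show ?thesis
    unfolding strong_dual_def by (simp add: topology_inverse')
qed

lemma topspace_strong_dual: "topspace (strong_dual s T) = topological_dual s T"
proof
  show "topspace (strong_dual s T) \<subseteq> topological_dual s T"
    using openin_strong_dual openin_topspace by blast
  have "openin (strong_dual s T) (topological_dual s T)"
    unfolding openin_strong_dual using tvs_bounded_empty[of s T] zero_less_one by blast
  then show "topological_dual s T \<subseteq> topspace (strong_dual s T)"
    by (rule openin_subset)
qed

definition countable_fan_tightness :: "'a topology \<Rightarrow> bool" where
  "countable_fan_tightness X \<longleftrightarrow>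
     (\<forall>x\<in>topspace X. \<forall>A :: nat \<Rightarrow> 'a set.
        (\<forall>n. A n \<subseteq> topspace X) \<and> x \<in> (\<Inter>n. X closure_of A n) \<longrightarrow>
        (\<exists>F :: nat \<Rightarrow> 'a set. (\<forall>n. finite (F n) \<and> F n \<subseteq> A n) \<and>
           x \<in> X closure_of (\<Union>n. F n)))"

end

theory Submission
  imports Defs
begin

text \<open>
Metrizable spaces are first countable, and first countability yields countable fan tightness:
choose one point of each \<open>A n\<close> inside the \<open>n\<close>-th member of a decreasing neighbourhood base.

The converse rests on the fact that the strong dual \<open>F\<close> of a strict (LF)-space has a neighbourhood
base at \<open>0\<close> indexed monotonically by \<open>\<nat> \<Rightarrow> \<nat>\<close>. By the theorem of Dieudonne and Schwartz
(\<open>bounded_subset_step\<close>, \<open>tvs_bounded_step\<close>) every bounded set lies in some step \<open>E n\<close> and is bounded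
there. In a metrizable space with base \<open>U 0, U 1, \<dots>\<close> at \<open>0\<close>, a set is bounded iff it is contained in
an intersection of multiples of the sets \<open>U i\<close>, and the sequence of factors is an element of
\<open>\<nat> \<Rightarrow> \<nat>\<close>. The number \<open>n\<close> of the step is coded as one more coordinate
(\<open>strict_LF_bounded_sets\<close>), and the radius of uniform convergence as another. The result is a base
of neighbourhoods \<open>N \<alpha>\<close> of \<open>0\<close> in \<open>F\<close> that shrink as \<open>\<alpha>\<close> grows.

Countable fan tightness turns such a base into a countable one
(\<open>countable_fan_tightness_imp_countable_base\<close>). Consider, for a finite list \<open>l\<close>, the intersection
\<open>D l\<close> of all \<open>N \<beta>\<close> with \<open>\<beta>\<close> extending \<open>l\<close>. There are countably many lists, so it is enough that every
\<open>\<alpha>\<close> has a finite initial segment \<open>l\<close> for which \<open>D l\<close> is a neighbourhood. Otherwise \<open>0\<close> lies in the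
closure of each complement of such a \<open>D l\<close>, and fan tightness selects finitely many points from each
complement that still accumulate at \<open>0\<close>. Each selected point avoids some \<open>N \<beta>\<close>; as only finitely
many of the \<open>\<beta>\<close> differ from \<open>\<alpha>\<close> at any given coordinate, they have a common pointwise upper bound
\<open>\<gamma>\<close>, and \<open>N \<gamma>\<close> contains none of the selected points.

Finally, countably many bounded sets that determine the neighbourhoods of \<open>0\<close> in \<open>F\<close> give an
explicit translation-invariant metric (\<open>metrizable_strong_dual\<close>).

The theorem of Dieudonne and Schwartz is obtained by constructing neighbourhoods of \<open>0\<close> in the
inductive limit as unions of finite sums \<open>W 0 + \<dots> + W k\<close>, where \<open>W k\<close> is an absolutely convex
neighbourhood in \<open>E k\<close> and \<open>(W (k + 1) + W (k + 1)) \<inter> E k \<subseteq> W k\<close>. This condition makes the sums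
collapse: a point of the union that lies in \<open>E k\<close> is already in \<open>W 0 + \<dots> + W k + W k\<close>. So the later
summands cannot spoil what was arranged at stage \<open>k\<close>.
\<close>

section \<open>Neighbourhoods, first countability and fan tightness\<close>

definition nbhd :: "'a topology \<Rightarrow> 'a \<Rightarrow> 'a set \<Rightarrow> bool" where
  "nbhd X x N \<longleftrightarrow> (\<exists>U. openin X U \<and> x \<in> U \<and> U \<subseteq> N)"

lemma nbhd_mono: "nbhd X x M \<Longrightarrow> M \<subseteq> N \<Longrightarrow> nbhd X x N"
  unfolding nbhd_def by blast

lemma nbhd_Int: "nbhd X x M \<Longrightarrow> nbhd X x N \<Longrightarrow> nbhd X x (M \<inter> N)"
  unfolding nbhd_def by (metis IntI Int_mono openin_Int)

lemma nbhd_openin: "openin X U \<Longrightarrow> x \<in> U \<Longrightarrow> nbhd X x U"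
  unfolding nbhd_def by blast

lemma openin_iff_nbhd: "openin X U \<longleftrightarrow> (\<forall>x\<in>U. nbhd X x U)"
  unfolding nbhd_def using openin_subopen[of X U] by metis

lemma nbhd_mem: "nbhd X x N \<Longrightarrow> x \<in> N"
  unfolding nbhd_def by blast

lemma nbhd_preimage:
  assumes "continuous_map X Y f" "x \<in> topspace X" "nbhd Y (f x) N"
  shows "nbhd X x {u \<in> topspace X. f u \<in> N}"
proof -
  obtain U where U: "openin Y U" "f x \<in> U" "U \<subseteq> N"
    using assms(3) unfolding nbhd_def by blast
  have "openin X {u \<in> topspace X. f u \<in> U}"
    using assms(1) U(1) by (rule openin_continuous_map_preimage)
  then show ?thesis
    unfolding nbhd_def using U assms(2) by blast
qed

text \<open>One point \<open>a n\<close> of \<open>A n\<close> suffices for each \<open>n\<close>, if it is taken in the intersection of the first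
\<open>n + 1\<close> members of a countable base.\<close>

lemma first_countable_imp_countable_fan_tightness:
  assumes "first_countable X"
  shows "countable_fan_tightness X"
  unfolding countable_fan_tightness_def
proof (intro ballI allI impI)
  fix x and A :: "nat \<Rightarrow> 'a set"
  assume x: "x \<in> topspace X"
    and A: "(\<forall>n. A n \<subseteq> topspace X) \<and> x \<in> (\<Inter>n. X closure_of A n)"
  obtain \<B> where \<B>: "countable \<B>" "\<And>V. V \<in> \<B> \<Longrightarrow> openin X V"
      "\<And>U. openin X U \<Longrightarrow> x \<in> U \<Longrightarrow> \<exists>V\<in>\<B>. x \<in> V \<and> V \<subseteq> U"
    using assms x unfolding first_countable_def by metis
  define \<C> where "\<C> = {V \<in> \<B>. x \<in> V}"
  have ne: "\<C> \<noteq> {}" and cC: "countable \<C>"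
    using \<B>(1) \<B>(3)[of "topspace X"] x by (auto simp: \<C>_def)
  define b where "b = from_nat_into \<C>"
  have bC: "b n \<in> \<C>" for n
    unfolding b_def using ne by (rule from_nat_into)
  have "openin X (\<Inter>i\<le>n. b i) \<and> x \<in> (\<Inter>i\<le>n. b i)" for n
    using bC \<B>(2) by (auto simp: \<C>_def intro!: openin_Inter)
  moreover have "x \<in> X closure_of A n" for n
    using A by blast
  ultimately have "\<exists>a. a \<in> A n \<and> a \<in> (\<Inter>i\<le>n. b i)" for n
    unfolding in_closure_of by meson
  then obtain a where a: "\<And>n. a n \<in> A n" "\<And>n. a n \<in> (\<Inter>i\<le>n. b i)"
    by metis
  have "x \<in> X closure_of (\<Union>n. {a n})"
    unfolding in_closure_of
  proof (intro conjI allI impI x)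
    fix U assume "x \<in> U \<and> openin X U"
    then obtain V where "V \<in> \<C>" "V \<subseteq> U"
      using \<B>(3) unfolding \<C>_def by blast
    moreover then obtain i where "b i = V"
      unfolding b_def using cC by (metis from_nat_into_surj)
    ultimately have "a i \<in> U"
      using a(2)[of i] by auto
    then show "\<exists>y. y \<in> (\<Union>n. {a n}) \<and> y \<in> U" by auto
  qed
  then show "\<exists>F. (\<forall>n. finite (F n) \<and> F n \<subseteq> A n) \<and> x \<in> X closure_of (\<Union>n. F n)"
    using a(1) by (intro exI[of _ "\<lambda>n. {a n}"]) auto
qed

text \<open>The members of the countable base are the sets \<open>D l\<close> for finite lists \<open>l\<close>. Assuming that no initial
segment of \<open>\<alpha>\<close> gives a neighbourhood, fan tightness is applied to the complements of the \<open>D l\<close>, and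
the indices that witness the non-membership of the selected points are dominated by one \<open>\<gamma>\<close>.\<close>

lemma countable_fan_tightness_imp_countable_base:
  fixes N :: "(nat \<Rightarrow> nat) \<Rightarrow> 'a set"
  assumes fan: "countable_fan_tightness X" and x: "x \<in> topspace X"
    and nbhd: "\<And>\<alpha>. nbhd X x (N \<alpha>)"
    and antimono: "\<And>\<alpha> \<beta>. \<alpha> \<le> \<beta> \<Longrightarrow> N \<beta> \<subseteq> N \<alpha>"
    and base: "\<And>U. openin X U \<Longrightarrow> x \<in> U \<Longrightarrow> \<exists>\<alpha>. N \<alpha> \<subseteq> U"
  shows "\<exists>\<B>. countable \<B> \<and> (\<forall>V\<in>\<B>. nbhd X x V) \<and>
           (\<forall>U. openin X U \<and> x \<in> U \<longrightarrow> (\<exists>V\<in>\<B>. V \<subseteq> U))"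
proof -
  define D where "D l = (\<Inter>\<beta>\<in>{\<beta>. \<forall>i<length l. \<beta> i = l ! i}. N \<beta>)" for l
  have ex: "\<exists>k. nbhd X x (D (map \<alpha> [0..<k]))" for \<alpha>
  proof (rule ccontr)
    assume no: "\<nexists>k. nbhd X x (D (map \<alpha> [0..<k]))"
    define A where "A k = topspace X - D (map \<alpha> [0..<k])" for k
    have "x \<in> X closure_of A k" for k
      unfolding in_closure_of
    proof (intro conjI allI impI x)
      fix U assume U: "x \<in> U \<and> openin X U"
      then have "\<not> U \<subseteq> D (map \<alpha> [0..<k])"
        using no unfolding nbhd_def by blast
      then show "\<exists>y. y \<in> A k \<and> y \<in> U"
        unfolding A_def using openin_subset U by blast
    qed
    then have "(\<forall>n. A n \<subseteq> topspace X) \<and> x \<in> (\<Inter>n. X closure_of A n)"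
      unfolding A_def by blast
    then have "\<exists>F. (\<forall>n. finite (F n) \<and> F n \<subseteq> A n) \<and> x \<in> X closure_of (\<Union>n. F n)"
      using fan x unfolding countable_fan_tightness_def by blast
    then obtain F where F: "\<And>n. finite (F n)" "\<And>n. F n \<subseteq> A n"
        "x \<in> X closure_of (\<Union>n. F n)"
      by blast
    have "\<exists>\<beta>. (\<forall>i<k. \<beta> i = \<alpha> i) \<and> y \<notin> N \<beta>" if "y \<in> F k" for k y
    proof -
      have "y \<notin> D (map \<alpha> [0..<k])"
        using F(2) that unfolding A_def by blast
      then show ?thesis
        unfolding D_def by auto
    qed
    then have "\<forall>k y. \<exists>\<beta>. y \<in> F k \<longrightarrow> (\<forall>i<k. \<beta> i = \<alpha> i) \<and> y \<notin> N \<beta>"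
      by blast
    then obtain B where "\<forall>k y. y \<in> F k \<longrightarrow> (\<forall>i<k. B k y i = \<alpha> i) \<and> y \<notin> N (B k y)"
      unfolding choice_iff by (rule exE)
    then have B: "\<And>k y i. y \<in> F k \<Longrightarrow> i < k \<Longrightarrow> B k y i = \<alpha> i"
        "\<And>k y. y \<in> F k \<Longrightarrow> y \<notin> N (B k y)"
      by blast+
    \<comment> \<open>Only \<open>k \<le> i\<close> matter: for \<open>k > i\<close> every \<open>B k y\<close> with \<open>y \<in> F k\<close> agrees with \<open>\<alpha>\<close> at \<open>i\<close>.\<close>
    define \<gamma> where "\<gamma> i = Max (insert (\<alpha> i) (\<Union>k\<le>i. (\<lambda>y. B k y i) ` F k))" for i
    have "B k y \<le> \<gamma>" if y: "y \<in> F k" for k y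
    proof (rule le_funI)
      fix i
      have fin: "finite (insert (\<alpha> i) (\<Union>k\<le>i. (\<lambda>y. B k y i) ` F k))"
        using F(1) by (intro finite.insertI finite_UN_I finite_imageI finite_atMost)
      have "B k y i \<in> insert (\<alpha> i) (\<Union>k\<le>i. (\<lambda>y. B k y i) ` F k)"
      proof (cases "i < k")
        case True
        then show ?thesis using B(1)[OF y] by simp
      next
        case False
        then have "k \<in> {..i}" by simp
        then show ?thesis using y by blast
      qed
      then show "B k y i \<le> \<gamma> i"
        unfolding \<gamma>_def using fin by (rule Max_ge[rotated])
    qed
    then have "y \<notin> N \<gamma>" if "y \<in> F k" for k y
      using B(2)[OF that] antimono that by blast
    moreover obtain y k where "y \<in> F k" "y \<in> N \<gamma>"
      using F(3) nbhd[of \<gamma>] unfolding in_closure_of nbhd_def by blast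
    ultimately show False by blast
  qed
  have "\<exists>l. nbhd X x (D l) \<and> D l \<subseteq> U" if U: "openin X U" "x \<in> U" for U
  proof -
    obtain \<alpha> where \<alpha>: "N \<alpha> \<subseteq> U"
      using base U by blast
    obtain k where "nbhd X x (D (map \<alpha> [0..<k]))"
      using ex by blast
    moreover have "D (map \<alpha> [0..<k]) \<subseteq> N \<alpha>"
      unfolding D_def by auto
    ultimately show ?thesis using \<alpha> by blast
  qed
  then show ?thesis
    by (intro exI[of _ "{V \<in> range D. nbhd X x V}"]) auto
qed

section \<open>The strong dual: neighbourhoods and metrizability\<close>

lemma topological_dual_diff:
  assumes "module.subspace s (topspace T)" "vector_space s"
    and f: "f \<in> topological_dual s T" and g: "g \<in> topological_dual s T"
  shows "restrict (\<lambda>x. f x - g x) (topspace T) \<in> topological_dual s T"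
proof -
  interpret vector_space s by fact
  have "continuous_map T euclidean (\<lambda>x. f x - g x)"
    using f g by (auto simp: topological_dual_def intro: continuous_map_diff)
  then have "continuous_map T euclidean (restrict (\<lambda>x. f x - g x) (topspace T))"
    by (rule continuous_map_eq) simp
  then show ?thesis
    using f g assms(1) by (auto simp: topological_dual_def subspace_def algebra_simps)
qed

lemma topological_dual_zero:
  fixes s :: "'k::real_normed_field \<Rightarrow> 'a::ab_group_add \<Rightarrow> 'a"
  assumes "module.subspace s (topspace T)" "vector_space s"
  shows "restrict (\<lambda>x. 0) (topspace T) \<in> topological_dual s T"
proof -
  interpret vector_space s by fact
  have "continuous_map T euclidean (restrict (\<lambda>x. 0::'k) (topspace T))"
    by (rule continuous_map_eq[of _ _ "\<lambda>x. 0"]) simp_all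
  then show ?thesis
    using assms(1) by (auto simp: topological_dual_def subspace_def)
qed

text \<open>The set of functionals within \<open>e\<close> of \<open>f\<close> on \<open>B\<close> need not be open, but the functionals whose
distance from \<open>f\<close> on \<open>B\<close> is bounded by some \<open>e' < e\<close> form an open set between \<open>f\<close> and it.\<close>

lemma nbhd_strong_dual:
  assumes f: "f \<in> topological_dual s T"
  shows "nbhd (strong_dual s T) f W \<longleftrightarrow>
    (\<exists>B e. tvs_bounded s T B \<and> e > 0 \<and>
      {g \<in> topological_dual s T. \<forall>x\<in>B. norm (g x - f x) \<le> e} \<subseteq> W)" (is "?l \<longleftrightarrow> ?r")
proof
  show "?l \<Longrightarrow> ?r"
    unfolding nbhd_def openin_strong_dual by (meson subset_trans)
  assume ?r
  then obtain B e where B: "tvs_bounded s T B" "e > 0"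
    and W: "{g \<in> topological_dual s T. \<forall>x\<in>B. norm (g x - f x) \<le> e} \<subseteq> W" by blast
  define O' where "O' = {g \<in> topological_dual s T. \<exists>e'<e. \<forall>x\<in>B. norm (g x - f x) \<le> e'}"
  have "openin (strong_dual s T) O'"
    unfolding openin_strong_dual
  proof (intro conjI ballI)
    show "O' \<subseteq> topological_dual s T" unfolding O'_def by blast
    fix g assume "g \<in> O'"
    then obtain e' where e': "e' < e" "\<And>x. x \<in> B \<Longrightarrow> norm (g x - f x) \<le> e'"
      unfolding O'_def by blast
    have "{h \<in> topological_dual s T. \<forall>x\<in>B. norm (h x - g x) \<le> (e - e') / 2} \<subseteq> O'"
    proof
      fix h assume h: "h \<in> {h \<in> topological_dual s T. \<forall>x\<in>B. norm (h x - g x) \<le> (e - e') / 2}"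
      have "norm (h x - f x) \<le> (e + e') / 2" if "x \<in> B" for x
      proof -
        have "norm (h x - f x) \<le> norm (h x - g x) + norm (g x - f x)"
          using norm_triangle_ineq[of "h x - g x" "g x - f x"] by simp
        moreover have "norm (h x - g x) \<le> (e - e') / 2"
          using h that by blast
        ultimately show ?thesis using e'(2)[OF that] by argo
      qed
      moreover have "(e + e') / 2 < e" using e'(1) by simp
      ultimately show "h \<in> O'" unfolding O'_def using h by blast
    qed
    then show "\<exists>B e. tvs_bounded s T B \<and> 0 < e \<and>
        {h \<in> topological_dual s T. \<forall>x\<in>B. norm (h x - g x) \<le> e} \<subseteq> O'"
      using B(1) e'(1) by (intro exI[of _ B] exI[of _ "(e - e') / 2"]) auto
  qed
  moreover have "f \<in> O'"
    unfolding O'_def using f B(2) by (auto intro: exI[of _ 0])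
  moreover have "O' \<subseteq> W"
    using W unfolding O'_def by force
  ultimately show ?l unfolding nbhd_def by blast
qed

lemma tvs_bounded_UN:
  assumes "finite I" "\<And>i. i \<in> I \<Longrightarrow> tvs_bounded s T (B i)"
  shows "tvs_bounded s T (\<Union>i\<in>I. B i)"
  using assms by (induction I) (auto simp: tvs_bounded_empty tvs_bounded_Un)

text \<open>The metric is the supremum over \<open>n\<close> of the uniform distances on \<open>B n\<close>, truncated at
\<open>c n = 1 / (n + 1)\<close>, where the bounded sets \<open>B n\<close> come from the countable base at \<open>0\<close>. Truncating the
individual values \<open>norm (f x - g x)\<close> makes the supremum finite, and \<open>c n \<longlonglongrightarrow> 0\<close> means that only finitely
many of the \<open>B n\<close> matter for a ball of given radius. Boundedness of singletons serves to separate
functionals.\<close>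

lemma metrizable_strong_dual:
  fixes s :: "'k::real_normed_field \<Rightarrow> 'a::ab_group_add \<Rightarrow> 'a"
  assumes sub: "module.subspace s (topspace T)" and vs: "vector_space s"
    and sing: "\<And>x. x \<in> topspace T \<Longrightarrow> tvs_bounded s T {x}"
    and \<B>: "countable \<B>" "\<And>V. V \<in> \<B> \<Longrightarrow> nbhd (strong_dual s T) (restrict (\<lambda>x. 0) (topspace T)) V"
      "\<And>U. openin (strong_dual s T) U \<Longrightarrow> restrict (\<lambda>x. 0) (topspace T) \<in> U \<Longrightarrow> \<exists>V\<in>\<B>. V \<subseteq> U"
  shows "metrizable_space (strong_dual s T)"
proof -
  let ?F = "topological_dual s T"
  let ?z = "restrict (\<lambda>x. 0) (topspace T) :: 'a \<Rightarrow> 'k"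
  have z: "?z \<in> ?F" using topological_dual_zero[OF sub vs] .
  have ne: "\<B> \<noteq> {}" using \<B>(3)[of ?F] z openin_topspace[of "strong_dual s T"]
    by (auto simp: topspace_strong_dual)
  define V where "V = from_nat_into \<B>"
  have "nbhd (strong_dual s T) ?z (V n)" for n
    unfolding V_def using ne by (intro \<B>(2) from_nat_into)
  then have "\<forall>n. \<exists>p. tvs_bounded s T (fst p) \<and> snd p > 0 \<and>
      {g \<in> ?F. \<forall>x\<in>fst p. norm (g x - ?z x) \<le> snd p} \<subseteq> V n"
    unfolding nbhd_strong_dual[OF z] by simp
  then obtain p where p: "\<forall>n. tvs_bounded s T (fst (p n)) \<and> snd (p n) > 0 \<and>
      {g \<in> ?F. \<forall>x\<in>fst (p n). norm (g x - ?z x) \<le> snd (p n)} \<subseteq> V n"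
    by (rule choice[THEN exE])
  define B where "B n = fst (p n)" for n
  define e where "e n = snd (p n)" for n
  have B: "tvs_bounded s T (B n)" and e: "e n > 0"
    and BV: "{g \<in> ?F. \<forall>x\<in>B n. norm (g x - ?z x) \<le> e n} \<subseteq> V n" for n
    using p unfolding B_def e_def by blast+
  have Bsub: "B n \<subseteq> topspace T" for n
    using B unfolding tvs_bounded_def by blast
  have key: "\<exists>n. \<forall>f\<in>?F. \<forall>g\<in>?F. (\<forall>x\<in>B n. norm (f x - g x) \<le> e n) \<longrightarrow> (\<forall>x\<in>C. norm (f x - g x) \<le> r)"
    if C: "tvs_bounded s T C" "r > 0" for C r
  proof -
    have "nbhd (strong_dual s T) ?z {g \<in> ?F. \<forall>x\<in>C. norm (g x - ?z x) \<le> r}"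
      using nbhd_strong_dual[OF z] C by blast
    then obtain W where "W \<in> \<B>" "W \<subseteq> {g \<in> ?F. \<forall>x\<in>C. norm (g x - ?z x) \<le> r}"
      using \<B>(3) unfolding nbhd_def by (meson subset_trans)
    moreover obtain n where "V n = W"
      unfolding V_def using \<open>W \<in> \<B>\<close> \<B>(1) by (metis from_nat_into_surj)
    ultimately have n: "V n \<subseteq> {g \<in> ?F. \<forall>x\<in>C. norm (g x - ?z x) \<le> r}" by simp
    have CT: "C \<subseteq> topspace T" using C(1) unfolding tvs_bounded_def by blast
    show ?thesis
    proof (intro exI[of _ n] ballI impI)
      fix f g x assume fg: "f \<in> ?F" "g \<in> ?F" and le: "\<forall>x\<in>B n. norm (f x - g x) \<le> e n" and x: "x \<in> C"
      let ?h = "restrict (\<lambda>x. f x - g x) (topspace T)"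
      have "?h \<in> ?F" using topological_dual_diff[OF sub vs fg] .
      moreover have "\<forall>x\<in>B n. norm (?h x - ?z x) \<le> e n"
        using le Bsub[of n] by auto
      ultimately have "?h \<in> V n" using BV by blast
      then have "norm (?h x - ?z x) \<le> r" using n x by blast
      then show "norm (f x - g x) \<le> r" using x CT by auto
    qed
  qed
  define c where "c n = inverse (real (Suc n))" for n
  have c: "0 < c n" "c n \<le> 1" for n
    unfolding c_def by (auto simp: divide_simps)
  have c_mono: "c m \<le> c n" if "n \<le> m" for m n
    unfolding c_def using that by (simp add: divide_simps)
  define S where "S f g = insert 0 {min (c n) (norm (f x - g x)) | n x. x \<in> B n}" for f g :: "'a \<Rightarrow> 'k"
  define d where "d f g = Sup (S f g)" for f g
  have bdd: "bdd_above (S f g)" for f g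
    unfolding S_def by (rule bdd_aboveI[of _ 1]) (use c in \<open>auto simp: min_le_iff_disj\<close>)
  have d_upper: "min (c n) (norm (f x - g x)) \<le> d f g" if "x \<in> B n" for f g n x
    unfolding d_def by (rule cSup_upper[OF _ bdd]) (use that in \<open>auto simp: S_def\<close>)
  have d_nonneg: "0 \<le> d f g" for f g
    unfolding d_def by (rule cSup_upper[OF _ bdd]) (auto simp: S_def)
  have d_least: "d f g \<le> t" if "0 \<le> t" "\<And>n x. x \<in> B n \<Longrightarrow> min (c n) (norm (f x - g x)) \<le> t" for f g t
    unfolding d_def by (rule cSup_least) (use that in \<open>auto simp: S_def\<close>)
  have small: "norm (f x - g x) \<le> e n" if "d f g < min (c n) (e n)" "x \<in> B n" for f g n x
    using d_upper[OF that(2), of f g] that(1) by linarith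
  interpret M: Metric_space ?F d
  proof
    show "0 \<le> d f g" for f g by (rule d_nonneg)
    show "d f g = d g f" for f g
      unfolding d_def S_def by (simp add: norm_minus_commute)
    show "d f g = 0 \<longleftrightarrow> f = g" if fg: "f \<in> ?F" "g \<in> ?F" for f g
    proof
      assume "f = g"
      have "d f f \<le> 0"
        by (rule d_least) (use c in \<open>auto simp: min_le_iff_disj\<close>)
      then show "d f g = 0" using \<open>f = g\<close> d_nonneg[of f f] by simp
    next
      assume d0: "d f g = 0"
      have eq: "f x = g x" if x: "x \<in> topspace T" for x
      proof -
        have "norm (f x - g x) \<le> r" if r: "r > 0" for r
        proof -
          obtain n where "\<forall>f\<in>?F. \<forall>g\<in>?F. (\<forall>x\<in>B n. norm (f x - g x) \<le> e n) \<longrightarrow> (\<forall>x\<in>{x}. norm (f x - g x) \<le> r)"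
            using key[OF sing[OF x] r] by blast
          moreover have "\<forall>x\<in>B n. norm (f x - g x) \<le> e n"
            using small[of f g n] d0 c(1)[of n] e[of n] by auto
          ultimately show ?thesis using fg by blast
        qed
        then have "norm (f x - g x) \<le> 0" by (rule field_le_epsilon) simp
        then show ?thesis by simp
      qed
      show "f = g"
        using fg eq by (intro extensionalityI[of f "topspace T" g]) (auto simp: topological_dual_def)
    qed
    show "d f h \<le> d f g + d g h" for f g h
    proof (rule d_least)
      show "0 \<le> d f g + d g h" using d_nonneg by (simp add: add_nonneg_nonneg)
      fix n x assume x: "x \<in> B n"
      have "norm (f x - h x) \<le> norm (f x - g x) + norm (g x - h x)"
        using norm_triangle_ineq[of "f x - g x" "g x - h x"] by simp
      then have "min (c n) (norm (f x - h x)) \<le> min (c n) (norm (f x - g x)) + min (c n) (norm (g x - h x))"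
        using c(1)[of n] norm_ge_zero[of "f x - g x"] norm_ge_zero[of "g x - h x"] by linarith
      also have "\<dots> \<le> d f g + d g h"
        using d_upper[OF x] by (intro add_mono)
      finally show "min (c n) (norm (f x - h x)) \<le> d f g + d g h" .
    qed
  qed
  have "strong_dual s T = M.mtopology"
  proof (rule topology_eq[THEN iffD2], intro allI iffI)
    fix U assume U: "openin (strong_dual s T) U"
    show "openin M.mtopology U"
      unfolding M.openin_mtopology
    proof (intro conjI allI impI)
      show UF: "U \<subseteq> ?F" using U openin_strong_dual by blast
      fix f assume f: "f \<in> U"
      then obtain C r where C: "tvs_bounded s T C" "r > 0"
        and CU: "{g \<in> ?F. \<forall>x\<in>C. norm (g x - f x) \<le> r} \<subseteq> U"
        using U unfolding openin_strong_dual by blast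
      obtain n where n: "\<forall>f\<in>?F. \<forall>g\<in>?F. (\<forall>x\<in>B n. norm (f x - g x) \<le> e n) \<longrightarrow> (\<forall>x\<in>C. norm (f x - g x) \<le> r)"
        using key[OF C] by blast
      have "M.mball f (min (c n) (e n)) \<subseteq> U"
      proof
        fix g assume g: "g \<in> M.mball f (min (c n) (e n))"
        then have "d g f < min (c n) (e n)" "g \<in> ?F" by (auto simp: M.commute)
        then have "\<forall>x\<in>C. norm (g x - f x) \<le> r"
          using n small[of g f n] f UF by blast
        then show "g \<in> U" using CU \<open>g \<in> ?F\<close> by blast
      qed
      then show "\<exists>r>0. M.mball f r \<subseteq> U"
        using c(1)[of n] e[of n] by (intro exI[of _ "min (c n) (e n)"]) auto
    qed
  next
    fix U assume U: "openin M.mtopology U"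
    show "openin (strong_dual s T) U"
      unfolding openin_strong_dual
    proof (intro conjI ballI)
      show UF: "U \<subseteq> ?F" using U M.openin_mtopology by blast
      fix f assume f: "f \<in> U"
      then obtain r where r: "r > 0" "M.mball f r \<subseteq> U"
        using U M.openin_mtopology by blast
      obtain K where K: "c K < r"
        unfolding c_def using r(1) reals_Archimedean by blast
      have "{g \<in> ?F. \<forall>x\<in>(\<Union>n\<in>{..K}. B n). norm (g x - f x) \<le> r / 2} \<subseteq> U"
      proof
        fix g assume g: "g \<in> {g \<in> ?F. \<forall>x\<in>(\<Union>n\<in>{..K}. B n). norm (g x - f x) \<le> r / 2}"
        have "d f g \<le> max (c K) (r / 2)"
        proof (rule d_least)
          show "0 \<le> max (c K) (r / 2)" using r by simp
          fix n x assume x: "x \<in> B n"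
          show "min (c n) (norm (f x - g x)) \<le> max (c K) (r / 2)"
          proof (cases "n \<le> K")
            case True
            then have "norm (g x - f x) \<le> r / 2" using g x by blast
            then show ?thesis by (simp add: norm_minus_commute)
          next
            case False
            then have "c n \<le> c K" by (intro c_mono) simp
            then show ?thesis by simp
          qed
        qed
        also have "\<dots> < r" using K r(1) by simp
        finally have "g \<in> M.mball f r" using g f UF by auto
        then show "g \<in> U" using r(2) by blast
      qed
      moreover have "tvs_bounded s T (\<Union>n\<in>{..K}. B n)"
        by (rule tvs_bounded_UN) (auto simp: B)
      ultimately show "\<exists>B e. tvs_bounded s T B \<and> e > 0 \<and> {g \<in> ?F. \<forall>x\<in>B. norm (g x - f x) \<le> e} \<subseteq> U"
        using r(1) half_gt_zero by blast
    qed
  qed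
  then show ?thesis
    using M.metrizable_space_mtopology by simp
qed

section \<open>Topological vector spaces and absolutely convex neighbourhoods\<close>

lemma topological_vector_spaceD:
  assumes "topological_vector_space s T"
  shows "vector_space s" "module.subspace s (topspace T)" "0 \<in> topspace T"
    "\<And>x y. x \<in> topspace T \<Longrightarrow> y \<in> topspace T \<Longrightarrow> x + y \<in> topspace T"
    "\<And>x y. x \<in> topspace T \<Longrightarrow> y \<in> topspace T \<Longrightarrow> x - y \<in> topspace T"
    "\<And>c x. x \<in> topspace T \<Longrightarrow> s c x \<in> topspace T"
proof -
  show vs: "vector_space s" and sub: "module.subspace s (topspace T)"
    using assms unfolding topological_vector_space_def by blast+
  interpret vector_space s by fact
  show "0 \<in> topspace T"
    "\<And>x y. x \<in> topspace T \<Longrightarrow> y \<in> topspace T \<Longrightarrow> x + y \<in> topspace T"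
    "\<And>x y. x \<in> topspace T \<Longrightarrow> y \<in> topspace T \<Longrightarrow> x - y \<in> topspace T"
    "\<And>c x. x \<in> topspace T \<Longrightarrow> s c x \<in> topspace T"
    using sub subspace_0 subspace_add subspace_diff subspace_scale by blast+
qed

lemma continuous_map_scale:
  assumes "topological_vector_space s T"
  shows "continuous_map T T (s c)"
proof -
  have "continuous_map T (prod_topology euclidean T) (\<lambda>x. (c, x))"
    by (intro continuous_map_pairedI) simp_all
  moreover have "continuous_map (prod_topology euclidean T) T (\<lambda>(c, x). s c x)"
    using assms unfolding topological_vector_space_def by blast
  ultimately have "continuous_map T T ((\<lambda>(c, x). s c x) \<circ> (\<lambda>x. (c, x)))"
    by (rule continuous_map_compose)
  then show ?thesis by (simp add: comp_def)
qed

lemma continuous_map_translation: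
  assumes "topological_vector_space s T" "a \<in> topspace T"
  shows "continuous_map T T (\<lambda>x. a + x)"
proof -
  have "continuous_map T (prod_topology T T) (\<lambda>x. (a, x))"
    by (intro continuous_map_pairedI) (simp_all add: assms(2))
  moreover have "continuous_map (prod_topology T T) T (\<lambda>(x, y). x + y)"
    using assms(1) unfolding topological_vector_space_def by blast
  ultimately have "continuous_map T T ((\<lambda>(x, y). x + y) \<circ> (\<lambda>x. (a, x)))"
    by (rule continuous_map_compose)
  then show ?thesis by (simp add: comp_def)
qed

lemma nbhd_zero_topspace:
  "topological_vector_space s T \<Longrightarrow> nbhd T 0 (topspace T)"
  by (rule nbhd_openin) (simp_all add: topological_vector_spaceD(3))

lemma nbhd_translation:
  assumes T: "topological_vector_space s T" and x: "x \<in> topspace T" and N: "nbhd T 0 N"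
  shows "nbhd T x {y \<in> topspace T. y - x \<in> N}"
proof -
  note v = topological_vector_spaceD[OF T]
  have "continuous_map T T (\<lambda>y. - x + y)"
    using continuous_map_translation[OF T v(5)[OF v(3) x]] by simp
  from nbhd_preimage[OF this x, of N] show ?thesis
    using N by simp
qed

lemma nbhd_zero_scale:
  assumes T: "topological_vector_space s T" and N: "nbhd T 0 N"
  shows "nbhd T 0 {x \<in> topspace T. s c x \<in> N}"
proof -
  interpret vector_space s using T by (rule topological_vector_spaceD)
  show ?thesis
    by (rule nbhd_preimage[OF continuous_map_scale[OF T]])
      (use N topological_vector_spaceD(3)[OF T] in simp_all)
qed

text \<open>Joint continuity of the scalar multiplication at \<open>(0, x)\<close>: the neighbourhood \<open>W\<close> of \<open>x\<close> is independent
of the scalar.\<close>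

lemma small_multiples_in_nbhd:
  assumes T: "topological_vector_space s T" and N: "nbhd T 0 N" and x: "x \<in> topspace T"
  shows "\<exists>\<delta>>0. \<exists>W. openin T W \<and> x \<in> W \<and> (\<forall>c. norm c < \<delta> \<longrightarrow> (\<forall>w\<in>W. s c w \<in> N))"
proof -
  interpret vector_space s using T by (rule topological_vector_spaceD)
  obtain U where U: "openin T U" "0 \<in> U" "U \<subseteq> N"
    using N unfolding nbhd_def by blast
  have "continuous_map (prod_topology euclidean T) T (\<lambda>(c, x). s c x)"
    using T unfolding topological_vector_space_def by blast
  from openin_continuous_map_preimage[OF this U(1)]
  have op: "openin (prod_topology euclidean T) {p \<in> UNIV \<times> topspace T. (\<lambda>(c, x). s c x) p \<in> U}"
    by simp
  have mem: "(0, x) \<in> {p \<in> UNIV \<times> topspace T. (\<lambda>(c, x). s c x) p \<in> U}"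
    by (simp only: mem_Collect_eq mem_Times_iff fst_conv snd_conv case_prod_conv
        scale_zero_left x U(2) UNIV_I simp_thms)
  obtain C W where CW: "openin euclidean C" "openin T W" "0 \<in> C" "x \<in> W"
      "C \<times> W \<subseteq> {p \<in> UNIV \<times> topspace T. (\<lambda>(c, x). s c x) p \<in> U}"
    using op[unfolded openin_prod_topology_alt, rule_format, OF mem] by (elim exE conjE) rule
  obtain \<delta> where \<delta>: "\<delta> > 0" "ball 0 \<delta> \<subseteq> C"
    using openE[OF CW(1)[folded open_openin] CW(3)] by blast
  have "s c w \<in> N" if "norm c < \<delta>" "w \<in> W" for c w
  proof -
    have "c \<in> C" using \<delta>(2) that(1) by (auto simp: dist_norm)
    then show ?thesis using CW(5) that(2) U(3) by auto
  qed
  then show ?thesis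
    using \<delta>(1) CW(2,4) by (intro exI[of _ \<delta>] conjI exI[of _ W]) simp_all
qed

lemma absorbing_nbhd_zero:
  assumes T: "topological_vector_space s T" and N: "nbhd T 0 N" and x: "x \<in> topspace T"
  shows "\<exists>\<delta>>0. \<forall>c. norm c < \<delta> \<longrightarrow> s c x \<in> N"
  using small_multiples_in_nbhd[OF T N x] by blast

lemma tvs_boundedD:
  assumes "tvs_bounded s T B" "nbhd T 0 V"
  shows "\<exists>r>0. \<forall>c. norm c \<ge> r \<longrightarrow> B \<subseteq> s c ` V"
proof -
  obtain U where U: "openin T U" "0 \<in> U" "U \<subseteq> V" using assms(2) unfolding nbhd_def by blast
  then obtain r where "r > 0" "\<forall>c. norm c \<ge> r \<longrightarrow> B \<subseteq> s c ` U"
    using assms(1) unfolding tvs_bounded_def by blast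
  then show ?thesis using U(3) by (meson image_mono subset_trans)
qed

lemma tvs_bounded_singleton:
  assumes T: "topological_vector_space s T" and x: "x \<in> topspace T"
  shows "tvs_bounded s T {x}"
  unfolding tvs_bounded_def
proof (intro conjI allI impI)
  interpret vector_space s using T by (rule topological_vector_spaceD)
  show "{x} \<subseteq> topspace T" using x by simp
  fix U assume "openin T U \<and> 0 \<in> U"
  then obtain \<delta> where \<delta>: "\<delta> > 0" "\<And>c. norm c < \<delta> \<Longrightarrow> s c x \<in> U"
    using absorbing_nbhd_zero[OF T nbhd_openin x] by blast
  have "{x} \<subseteq> s c ` U" if c: "2 / \<delta> \<le> norm c" for c
  proof -
    have c0: "0 < norm c" using c \<delta>(1) by (smt (verit) divide_pos_pos)
    have "1 < norm c * \<delta>" using c \<delta>(1) by (smt (verit) pos_divide_le_eq)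
    then have "norm (inverse c) < \<delta>"
      using c0 \<delta>(1) by (simp add: norm_inverse norm_divide divide_simps mult.commute)
    then have "s (inverse c) x \<in> U" by (rule \<delta>(2))
    moreover have "x = s c (s (inverse c) x)" using c0 by simp
    ultimately show ?thesis by blast
  qed
  then show "\<exists>r>0. \<forall>c. r \<le> norm c \<longrightarrow> {x} \<subseteq> s c ` U"
    using \<delta>(1) by (intro exI[of _ "2 / \<delta>"]) simp
qed

text \<open>Convex and balanced at once, where balanced means stable under all scalars of norm at most \<open>1\<close>,
not just the real ones.\<close>

definition absolutely_convex ::
  "('k::real_normed_field \<Rightarrow> 'a::ab_group_add \<Rightarrow> 'a) \<Rightarrow> 'a set \<Rightarrow> bool" where
  "absolutely_convex s V \<longleftrightarrow>
     (\<forall>x\<in>V. \<forall>y\<in>V. \<forall>a b. norm a + norm b \<le> 1 \<longrightarrow> s a x + s b y \<in> V)"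

lemma absolutely_convexD:
  "absolutely_convex s V \<Longrightarrow> x \<in> V \<Longrightarrow> y \<in> V \<Longrightarrow> norm a + norm b \<le> 1 \<Longrightarrow> s a x + s b y \<in> V"
  unfolding absolutely_convex_def by blast

lemma absolutely_convex_imp_convex_wrt:
  assumes "absolutely_convex s V"
  shows "convex_wrt s V"
  unfolding convex_wrt_def
proof (intro ballI allI impI)
  fix x y u v assume "x \<in> V" "y \<in> V" "0 \<le> (u::real)" "0 \<le> (v::real)" "u + v = 1"
  then show "s (of_real u) x + s (of_real v) y \<in> V"
    by (intro absolutely_convexD[OF assms]) simp_all
qed

lemma absolutely_convex_Int:
  "absolutely_convex s V \<Longrightarrow> absolutely_convex s W \<Longrightarrow> absolutely_convex s (V \<inter> W)"
  unfolding absolutely_convex_def by blast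

lemma absolutely_convex_dilate:
  fixes s :: "'k::real_normed_field \<Rightarrow> 'a::ab_group_add \<Rightarrow> 'a"
  assumes "topological_vector_space s T" "absolutely_convex s V"
  shows "absolutely_convex s {x \<in> topspace T. s c x \<in> V}"
  unfolding absolutely_convex_def
proof (intro ballI allI impI)
  interpret vector_space s using assms(1) by (rule topological_vector_spaceD)
  fix x y and a b :: 'k assume xy: "x \<in> {x \<in> topspace T. s c x \<in> V}" "y \<in> {x \<in> topspace T. s c x \<in> V}"
    and ab: "norm a + norm b \<le> 1"
  have "s a (s c x) + s b (s c y) \<in> V"
    using absolutely_convexD[OF assms(2) _ _ ab] xy by blast
  then have "s c (s a x + s b y) \<in> V"
    by (simp add: scale_right_distrib mult.commute)
  then show "s a x + s b y \<in> {x \<in> topspace T. s c x \<in> V}"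
    using xy topological_vector_spaceD(4,6)[OF assms(1)] by blast
qed

text \<open>From a convex neighbourhood \<open>C\<close> the set \<open>A\<close> of all \<open>x\<close> with \<open>s c x \<in> C\<close> for all scalars \<open>c\<close> of norm at most \<open>2\<close> is cut out.
It is balanced by construction and inherits convexity from \<open>C\<close>, and joint continuity at \<open>(0, 0)\<close>
makes it a neighbourhood. The bound \<open>2\<close> in place of \<open>1\<close> gives \<open>A + A \<subseteq> C\<close>, because
\<open>x + y\<close> is the midpoint of \<open>2 x\<close> and \<open>2 y\<close>.\<close>

lemma absolutely_convex_nbhd_zero:
  fixes s :: "'k::real_normed_field \<Rightarrow> 'a::ab_group_add \<Rightarrow> 'a"
  assumes lc: "locally_convex_space s T" and N: "nbhd T 0 N"
  shows "\<exists>W. absolutely_convex s W \<and> nbhd T 0 W \<and> W \<subseteq> topspace T \<and> (\<forall>x\<in>W. \<forall>y\<in>W. x + y \<in> N)"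
proof -
  have T: "topological_vector_space s T"
    using lc unfolding locally_convex_space_def by blast
  interpret vector_space s using T by (rule topological_vector_spaceD)
  have conv: "\<forall>U. openin T U \<and> 0 \<in> U \<longrightarrow>
       (\<exists>V C. openin T V \<and> 0 \<in> V \<and> V \<subseteq> C \<and> C \<subseteq> U \<and> convex_wrt s C)"
    using lc unfolding locally_convex_space_def by blast
  obtain C where C: "nbhd T 0 C" "C \<subseteq> N" "convex_wrt s C"
  proof -
    obtain U where U: "openin T U" "0 \<in> U" "U \<subseteq> N"
      using N unfolding nbhd_def by blast
    obtain V C where "openin T V" "0 \<in> V" "V \<subseteq> C" "C \<subseteq> U" "convex_wrt s C"
      using conv[rule_format, OF conjI[OF U(1,2)]] by (elim exE conjE) rule
    then have "nbhd T 0 C" "C \<subseteq> N" "convex_wrt s C"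
      using U(3) nbhd_mono[OF nbhd_openin[of T V 0]] by simp_all
    then show ?thesis by (rule that)
  qed
  define A where "A = {x \<in> topspace T. \<forall>c. norm c \<le> 2 \<longrightarrow> s c x \<in> C}"
  have scale: "s c x \<in> A" if "x \<in> A" "norm c \<le> 1" for c x
  proof -
    have "s d (s c x) \<in> C" if "norm d \<le> 2" for d
    proof -
      have "norm (d * c) \<le> 2 * 1"
        unfolding norm_mult using that \<open>norm c \<le> 1\<close> by (intro mult_mono) auto
      then show ?thesis using \<open>x \<in> A\<close> unfolding A_def by simp
    qed
    then show ?thesis
      using that topological_vector_spaceD(6)[OF T] unfolding A_def by blast
  qed
  have convA: "s (of_real u) x + s (of_real v) y \<in> A"
    if xy: "x \<in> A" "y \<in> A" and uv: "u \<ge> 0" "v \<ge> 0" "u + v = 1" for x y u v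
  proof -
    have "s d (s (of_real u) x + s (of_real v) y) \<in> C" if "norm d \<le> 2" for d
    proof -
      have "s d x \<in> C" "s d y \<in> C" using xy that unfolding A_def by blast+
      then have "s (of_real u) (s d x) + s (of_real v) (s d y) \<in> C"
        using C(3) uv unfolding convex_wrt_def by blast
      then show ?thesis by (simp add: scale_right_distrib mult.commute)
    qed
    then show ?thesis
      using xy topological_vector_spaceD(4,6)[OF T] unfolding A_def by blast
  qed
  have "absolutely_convex s A"
    unfolding absolutely_convex_def
  proof (intro ballI allI impI)
    fix x y and a b :: 'k
    assume xy: "x \<in> A" "y \<in> A" and ab: "norm a + norm b \<le> 1"
    define t where "t = norm a + norm b"
    show "s a x + s b y \<in> A"
    proof (cases "t = 0")
      case True
      then have ab0: "a = 0" "b = 0"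
        using norm_ge_zero[of a] norm_ge_zero[of b] unfolding t_def
        by (simp_all add: add_nonneg_eq_0_iff)
      have "s 0 x \<in> A" using scale[OF xy(1), of 0] by simp
      then show ?thesis using ab0 by simp
    next
      case False
      then have t: "0 < t" "t \<le> 1" using ab unfolding t_def by (auto simp: less_le)
      \<comment> \<open>\<open>s a x + s b y\<close> as a convex combination of \<open>x'\<close> and \<open>y'\<close>; if \<open>a = 0\<close>, then \<open>x' = 0\<close> since \<open>t / 0 = 0\<close>.\<close>
      define x' where "x' = s (of_real (t / norm a) * a) x"
      define y' where "y' = s (of_real (t / norm b) * b) y"
      have "x' \<in> A" unfolding x'_def
        by (rule scale[OF xy(1)]) (use t in \<open>cases "a = 0"; simp add: norm_mult norm_divide\<close>)
      moreover have "y' \<in> A" unfolding y'_def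
        by (rule scale[OF xy(2)]) (use t in \<open>cases "b = 0"; simp add: norm_mult norm_divide\<close>)
      moreover have "norm a / t + norm b / t = 1"
        using t unfolding t_def by (simp add: add_divide_distrib[symmetric])
      ultimately have "s (of_real (norm a / t)) x' + s (of_real (norm b / t)) y' \<in> A"
        using t by (intro convA) simp_all
      moreover have "s (of_real (norm a / t)) x' = s a x"
        unfolding x'_def using t by (cases "a = 0"; simp)
      moreover have "s (of_real (norm b / t)) y' = s b y"
        unfolding y'_def using t by (cases "b = 0"; simp)
      ultimately show ?thesis by simp
    qed
  qed
  moreover have "nbhd T 0 A"
  proof -
    obtain \<delta> W where \<delta>: "\<delta> > 0" and W: "openin T W" "0 \<in> W"
      and small: "\<And>c w. norm c < \<delta> \<Longrightarrow> w \<in> W \<Longrightarrow> s c w \<in> C"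
      using small_multiples_in_nbhd[OF T C(1) topological_vector_spaceD(3)[OF T]] by blast
    let ?r = "of_real (3 / \<delta>) :: 'k"
    have "{x \<in> topspace T. s ?r x \<in> W} \<subseteq> A"
    proof
      fix x assume x: "x \<in> {x \<in> topspace T. s ?r x \<in> W}"
      have "s c x \<in> C" if c: "norm c \<le> 2" for c
      proof -
        have "norm (c * of_real (\<delta> / 3)) \<le> 2 * (\<delta> / 3)"
          unfolding norm_mult using c \<delta> by (intro mult_mono) auto
        also have "\<dots> < \<delta>" using \<delta> by simp
        finally have "s (c * of_real (\<delta> / 3)) (s ?r x) \<in> C"
          using x by (intro small) auto
        moreover have "c * of_real (\<delta> / 3) * ?r = c"
          using \<delta> by simp
        ultimately show ?thesis by simp
      qed
      then show "x \<in> A" using x unfolding A_def by blast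
    qed
    moreover have "nbhd T 0 {x \<in> topspace T. s ?r x \<in> W}"
      using nbhd_zero_scale[OF T nbhd_openin[OF W]] .
    ultimately show ?thesis by (rule nbhd_mono[rotated])
  qed
  moreover have "x + y \<in> N" if "x \<in> A" "y \<in> A" for x y
  proof -
    have "s 2 x \<in> C" "s 2 y \<in> C" using that unfolding A_def by simp_all
    then have "s (of_real (1 / 2)) (s 2 x) + s (of_real (1 / 2)) (s 2 y) \<in> C"
      using C(3)[unfolded convex_wrt_def, rule_format, of "s 2 x" "s 2 y" "1/2" "1/2"] by simp
    then show ?thesis using C(2) by auto
  qed
  ultimately show ?thesis unfolding A_def by blast
qed

section \<open>Locally convex topologies and strict inductive limits\<close>

text \<open>A filter base of absolutely convex, absorbing sets that is stable under dilations is a neighbourhood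
base at \<open>0\<close> of a locally convex topology. Sums are controlled by the halves \<open>{x. 2 x \<in> V}\<close> of the
basic sets, and scalar multiples by
\<open>(c + d) (x + k) = c x + (d x + (c + d) k)\<close>, where absorption handles \<open>d x\<close> and a dilation handles
\<open>(c + d) k\<close>.\<close>

lemma locally_convex_topology_exists:
  fixes s :: "'k::real_normed_field \<Rightarrow> 'a::ab_group_add \<Rightarrow> 'a"
  assumes vs: "vector_space s" and X: "module.subspace s X"
    and ne: "\<V> \<noteq> {}" and sub: "\<And>V. V \<in> \<V> \<Longrightarrow> V \<subseteq> X"
    and ac: "\<And>V. V \<in> \<V> \<Longrightarrow> absolutely_convex s V"
    and Int: "\<And>V W. V \<in> \<V> \<Longrightarrow> W \<in> \<V> \<Longrightarrow> V \<inter> W \<in> \<V>"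
    and dilate: "\<And>V c. V \<in> \<V> \<Longrightarrow> {x \<in> X. s c x \<in> V} \<in> \<V>"
    and absorb: "\<And>V x. V \<in> \<V> \<Longrightarrow> x \<in> X \<Longrightarrow> \<exists>\<delta>>0. \<forall>c. norm c < \<delta> \<longrightarrow> s c x \<in> V"
  shows "\<exists>T. locally_convex_space s T \<and> topspace T = X \<and>
    (\<forall>U. openin T U \<longleftrightarrow> U \<subseteq> X \<and> (\<forall>x\<in>U. \<exists>V\<in>\<V>. \<forall>v\<in>V. x + v \<in> U)) \<and>
    (\<forall>V\<in>\<V>. nbhd T 0 V)"
proof -
  interpret vector_space s by fact
  note X0 = subspace_0[OF X] and Xadd = subspace_add[OF X] and Xscale = subspace_scale[OF X]
  define opn where "opn U \<longleftrightarrow> U \<subseteq> X \<and> (\<forall>x\<in>U. \<exists>V\<in>\<V>. \<forall>v\<in>V. x + v \<in> U)" for U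
  have opnD: "\<exists>V\<in>\<V>. \<forall>v\<in>V. x + v \<in> U" if "opn U" "x \<in> U" for U x
    using that unfolding opn_def by blast
  define T where "T = topology opn"
  have "opn (S \<inter> U)" if SU: "opn S" "opn U" for S U
    unfolding opn_def
  proof (intro conjI ballI)
    show "S \<inter> U \<subseteq> X" using SU unfolding opn_def by blast
    fix x assume "x \<in> S \<inter> U"
    then have "x \<in> S" "x \<in> U" by simp_all
    obtain V where V: "V \<in> \<V>" "\<forall>v\<in>V. x + v \<in> S"
      using opnD[OF SU(1) \<open>x \<in> S\<close>] by (elim bexE)
    obtain W where W: "W \<in> \<V>" "\<forall>v\<in>W. x + v \<in> U"
      using opnD[OF SU(2) \<open>x \<in> U\<close>] by (elim bexE)
    then show "\<exists>V\<in>\<V>. \<forall>v\<in>V. x + v \<in> S \<inter> U"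
      using Int[OF V(1) W(1)] V(2) W(2) by (intro bexI[of _ "V \<inter> W"]) simp_all
  qed
  moreover have "opn (\<Union>K)" if "\<forall>U\<in>K. opn U" for K
    unfolding opn_def
  proof (intro conjI ballI)
    show "\<Union>K \<subseteq> X" using that unfolding opn_def by blast
    fix x assume "x \<in> \<Union>K"
    then obtain U where U: "U \<in> K" "x \<in> U" by blast
    then have "\<exists>V\<in>\<V>. \<forall>v\<in>V. x + v \<in> U"
      using that by (intro opnD) simp_all
    then obtain V where "V \<in> \<V>" "\<forall>v\<in>V. x + v \<in> U"
      by (elim bexE)
    then show "\<exists>V\<in>\<V>. \<forall>v\<in>V. x + v \<in> \<Union>K" using U(1) by blast
  qed
  ultimately have "istopology opn" unfolding istopology_def by blast
  then have op: "openin T U \<longleftrightarrow> opn U" for U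
    unfolding T_def by (simp add: topology_inverse')
  have "opn X"
    unfolding opn_def using ne sub Xadd by blast
  then have top: "topspace T = X"
    using op openin_subset openin_topspace opn_def by (metis subset_antisym)
  define half where "half V = {x \<in> X. s 2 x \<in> V}" for V
  have half: "half V \<in> \<V>" and half_add: "h \<in> half V \<Longrightarrow> h' \<in> half V \<Longrightarrow> h + h' \<in> V"
    if V: "V \<in> \<V>" for V h h'
  proof -
    show "half V \<in> \<V>" unfolding half_def using dilate[OF V] .
    assume "h \<in> half V" "h' \<in> half V"
    then have "s (1/2) (s 2 h) + s (1/2) (s 2 h') \<in> V"
      unfolding half_def by (intro absolutely_convexD[OF ac[OF V]]) (auto simp: norm_divide)
    then show "h + h' \<in> V" by simp
  qed
  have zero: "0 \<in> V" if V: "V \<in> \<V>" for V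
    using absorb[OF V X0] by (metis norm_zero scale_zero_right)
  have nb: "nbhd T x N" if x: "x \<in> X" and V: "V \<in> \<V>" "\<And>v. v \<in> V \<Longrightarrow> x + v \<in> N" for x V N
  proof -
    define I where "I = {y \<in> X. \<exists>W\<in>\<V>. \<forall>w\<in>W. y + w \<in> N}"
    have "opn I"
      unfolding opn_def
    proof (intro conjI ballI)
      show "I \<subseteq> X" unfolding I_def by blast
      fix y assume "y \<in> I"
      then obtain W where y: "y \<in> X" and W: "W \<in> \<V>" "\<And>w. w \<in> W \<Longrightarrow> y + w \<in> N"
        unfolding I_def by blast
      have "y + h \<in> I" if h: "h \<in> half W" for h
      proof -
        have "y + h + h' \<in> N" if h': "h' \<in> half W" for h'
          using W(2)[OF half_add[OF W(1) h h']] by (simp add: add.assoc)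
        moreover have "y + h \<in> X" using y h Xadd unfolding half_def by blast
        ultimately show ?thesis unfolding I_def using half[OF W(1)] by blast
      qed
      then show "\<exists>V\<in>\<V>. \<forall>v\<in>V. y + v \<in> I" using half[OF W(1)] by blast
    qed
    moreover have "x \<in> I" unfolding I_def using x V by blast
    moreover have "I \<subseteq> N"
    proof
      fix y assume "y \<in> I"
      then obtain W where W: "W \<in> \<V>" "\<And>w. w \<in> W \<Longrightarrow> y + w \<in> N" unfolding I_def by blast
      show "y \<in> N" using W(2)[OF zero[OF W(1)]] by simp
    qed
    ultimately show ?thesis unfolding nbhd_def op by blast
  qed
  have nb0: "nbhd T 0 V" if "V \<in> \<V>" for V
    using nb[OF X0 that] by simp
  have add: "continuous_map (prod_topology T T) T (\<lambda>(x, y). x + y)"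
    unfolding continuous_map_def
  proof (intro conjI allI impI)
    show "(\<lambda>(x, y). x + y) \<in> topspace (prod_topology T T) \<rightarrow> topspace T"
      using Xadd by (auto simp: top)
    fix U assume U: "openin T U"
    show "openin (prod_topology T T) {p \<in> topspace (prod_topology T T). (\<lambda>(x, y). x + y) p \<in> U}"
      unfolding openin_prod_topology_alt
    proof (intro allI impI)
      fix x y assume "(x, y) \<in> {p \<in> topspace (prod_topology T T). (\<lambda>(x, y). x + y) p \<in> U}"
      then have xy: "x \<in> X" "y \<in> X" "x + y \<in> U" by (simp_all add: top)
      then obtain V where V: "V \<in> \<V>" "\<And>v. v \<in> V \<Longrightarrow> x + y + v \<in> U"
        using opnD[OF U[unfolded op] xy(3)] by blast
      have "nbhd T z {z + h | h. h \<in> half V}" if "z \<in> X" for z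
        by (rule nb[OF that half[OF V(1)]]) blast
      note nbz = this[unfolded nbhd_def]
      obtain A where A: "openin T A" "x \<in> A" "A \<subseteq> {x + h | h. h \<in> half V}"
        using nbz[OF xy(1)] by (elim exE conjE)
      obtain B where B: "openin T B" "y \<in> B" "B \<subseteq> {y + h | h. h \<in> half V}"
        using nbz[OF xy(2)] by (elim exE conjE)
      have "A \<times> B \<subseteq> {p \<in> topspace (prod_topology T T). (\<lambda>(x, y). x + y) p \<in> U}"
      proof (clarify, intro conjI)
        fix a b assume ab: "a \<in> A" "b \<in> B"
        then obtain h h' where h: "a = x + h" "b = y + h'" "h \<in> half V" "h' \<in> half V"
          using A(3) B(3) by blast
        have "x + y + (h + h') \<in> U" using V(2) half_add[OF V(1) h(3,4)] by blast
        then show "a + b \<in> U" using h(1,2) by (simp add: algebra_simps)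
        show "(a, b) \<in> topspace (prod_topology T T)"
          using ab A(1) B(1) openin_subset by fastforce
      qed
      then show "\<exists>A B. openin T A \<and> openin T B \<and> x \<in> A \<and> y \<in> B \<and>
          A \<times> B \<subseteq> {p \<in> topspace (prod_topology T T). (\<lambda>(x, y). x + y) p \<in> U}"
        using A(1,2) B(1,2) by (intro exI[of _ A] exI[of _ B] conjI)
    qed
  qed
  have scale: "continuous_map (prod_topology euclidean T) T (\<lambda>(c, x). s c x)"
    unfolding continuous_map_def
  proof (intro conjI allI impI)
    show "(\<lambda>(c, x). s c x) \<in> topspace (prod_topology euclidean T) \<rightarrow> topspace T"
      using Xscale by (auto simp: top)
    fix U assume U: "openin T U"
    show "openin (prod_topology euclidean T) {p \<in> topspace (prod_topology euclidean T). (\<lambda>(c, x). s c x) p \<in> U}"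
      unfolding openin_prod_topology_alt
    proof (intro allI impI)
      fix c :: 'k and x
      assume "(c, x) \<in> {p \<in> topspace (prod_topology euclidean T). (\<lambda>(c, x). s c x) p \<in> U}"
      then have x: "x \<in> X" "s c x \<in> U" by (simp_all add: top)
      then obtain V where V: "V \<in> \<V>" "\<And>v. v \<in> V \<Longrightarrow> s c x + v \<in> U"
        using opnD[OF U[unfolded op] x(2)] by blast
      obtain \<delta> where \<delta>: "\<delta> > 0" "\<And>d. norm d < \<delta> \<Longrightarrow> s d x \<in> half V"
        using absorb[OF half[OF V(1)] x(1)] by blast
      define M where "M = norm c + \<delta>"
      have M: "M > 0" unfolding M_def using \<delta>(1) by (simp add: add_nonneg_pos)
      define K where "K = {k \<in> X. s (of_real M) k \<in> half V}"
      have K: "K \<in> \<V>" unfolding K_def by (rule dilate[OF half[OF V(1)]])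
      have "nbhd T x {x + k | k. k \<in> K}"
        by (rule nb[OF x(1) K]) blast
      then obtain B where B: "openin T B" "x \<in> B" "B \<subseteq> {x + k | k. k \<in> K}"
        unfolding nbhd_def by blast
      have "ball c \<delta> \<times> B \<subseteq> {p \<in> topspace (prod_topology euclidean T). (\<lambda>(c, x). s c x) p \<in> U}"
      proof (clarify, intro conjI)
        fix d b assume d: "d \<in> ball c \<delta>" and b: "b \<in> B"
        then obtain k where k: "b = x + k" "k \<in> K" using B(3) by blast
        have dc: "norm (d - c) < \<delta>" using d by (simp add: dist_norm norm_minus_commute)
        have "norm d \<le> norm (d - c) + norm c"
          using norm_triangle_ineq[of "d - c" c] by simp
        then have dM: "norm d \<le> M" unfolding M_def using dc by linarith
        have "s (d / of_real M) (s (of_real M) k) + s 0 (s (of_real M) k) \<in> half V"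
          using k(2) dM M unfolding K_def
          by (intro absolutely_convexD[OF ac[OF half[OF V(1)]]]) (auto simp: norm_divide)
        then have "s d k \<in> half V" using M by simp
        then have "s c x + (s (d - c) x + s d k) \<in> U"
          using V(2) half_add[OF V(1)] \<delta>(2)[OF dc] by blast
        then show "s d b \<in> U" using k(1) by (simp add: algebra_simps)
        show "(d, b) \<in> topspace (prod_topology euclidean T)"
          using b B(1) openin_subset by fastforce
      qed
      then show "\<exists>A B. openin euclidean A \<and> openin T B \<and> c \<in> A \<and> x \<in> B \<and>
          A \<times> B \<subseteq> {p \<in> topspace (prod_topology euclidean T). (\<lambda>(c, x). s c x) p \<in> U}"
        using B(1,2) \<delta>(1) by (intro exI[of _ "ball c \<delta>"] exI[of _ B] conjI) simp_all
    qed
  qed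
  have "locally_convex_space s T"
    unfolding locally_convex_space_def topological_vector_space_def
  proof (intro conjI allI impI)
    show "vector_space s" by fact
    show "subspace (topspace T)" using X top by simp
    show "continuous_map (prod_topology T T) T (\<lambda>(x, y). x + y)" by fact
    show "continuous_map (prod_topology euclidean T) T (\<lambda>(c, x). s c x)" by fact
    fix U assume "openin T U \<and> 0 \<in> U"
    then obtain V where V: "V \<in> \<V>" "\<And>v. v \<in> V \<Longrightarrow> 0 + v \<in> U"
      unfolding op opn_def by blast
    obtain W where W: "openin T W" "0 \<in> W" "W \<subseteq> V"
      using nb0[OF V(1)] unfolding nbhd_def by blast
    have "V \<subseteq> U" using V(2) by auto
    then show "\<exists>V C. openin T V \<and> 0 \<in> V \<and> V \<subseteq> C \<and> C \<subseteq> U \<and> convex_wrt s C"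
      using W absolutely_convex_imp_convex_wrt[OF ac[OF V(1)]]
      by (intro exI[of _ W] exI[of _ V] conjI)
  qed
  then show ?thesis
    using top op nb0 unfolding opn_def by (intro exI[of _ T]) simp
qed

lemma strict_inductive_limit_step:
  assumes lim: "strict_inductive_limit s E T" and "i \<le> j"
  shows "topspace (E i) \<subseteq> topspace (E j)" "E i = subtopology (E j) (topspace (E i))"
proof -
  have "topspace (E i) \<subseteq> topspace (E j) \<and> E i = subtopology (E j) (topspace (E i))"
    using \<open>i \<le> j\<close>
  proof (induction j rule: dec_induct)
    case base
    then show ?case by simp
  next
    case (step k)
    have k: "topspace (E k) \<subseteq> topspace (E (Suc k))" "E k = subtopology (E (Suc k)) (topspace (E k))"
      using lim unfolding strict_inductive_limit_def by blast+
    have "E i = subtopology (E k) (topspace (E i))" using step.IH by blast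
    also have "\<dots> = subtopology (subtopology (E (Suc k)) (topspace (E k))) (topspace (E i))"
      using k(2) by simp
    also have "\<dots> = subtopology (E (Suc k)) (topspace (E i))"
      using step.IH by (simp add: subtopology_subtopology Int_absorb1)
    finally show ?case using step.IH k(1) by (metis subset_trans)
  qed
  then show "topspace (E i) \<subseteq> topspace (E j)" "E i = subtopology (E j) (topspace (E i))"
    by blast+
qed

text \<open>Dropping finitely many steps does not change the limit. This lets statements about an arbitrary step
be proved for the first step only.\<close>

lemma strict_inductive_limit_shift:
  assumes lim: "strict_inductive_limit s E T"
  shows "strict_inductive_limit s (\<lambda>k. E (n + k)) T"
proof -
  note step = strict_inductive_limit_step[OF lim]
  have lc: "locally_convex_space s (E k)" and T: "locally_convex_space s T"
    and top: "topspace T = (\<Union>n. topspace (E n))" and cont: "continuous_map (E k) T id" for k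
    using lim unfolding strict_inductive_limit_def by blast+
  have fin: "continuous_map T T' id"
    if "locally_convex_space s T'" "topspace T' = topspace T" "\<And>n. continuous_map (E n) T' id" for T'
    using lim that unfolding strict_inductive_limit_def by blast
  show ?thesis
    unfolding strict_inductive_limit_def
  proof (intro conjI allI impI)
    show "locally_convex_space s (E (n + k))" for k by (rule lc)
    show "topspace (E (n + k)) \<subseteq> topspace (E (n + Suc k))" for k by (rule step) simp
    show "E (n + k) = subtopology (E (n + Suc k)) (topspace (E (n + k)))" for k by (rule step) simp
    show "locally_convex_space s T" by fact
    show "topspace T = (\<Union>k. topspace (E (n + k)))"
      unfolding top
    proof (intro equalityI UN_least)
      fix k
      have "topspace (E k) \<subseteq> topspace (E (n + k))" by (rule step) simp
      then show "topspace (E k) \<subseteq> (\<Union>k. topspace (E (n + k)))" by blast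
      show "topspace (E (n + k)) \<subseteq> (\<Union>n. topspace (E n))" by blast
    qed
    show "continuous_map (E (n + k)) T id" for k by (rule cont)
    fix T' assume T': "locally_convex_space s T' \<and> topspace T' = topspace T \<and>
        (\<forall>k. continuous_map (E (n + k)) T' id)"
    show "continuous_map T T' id"
    proof (rule fin)
      fix k
      have "E k = subtopology (E (n + k)) (topspace (E k))" by (rule step) simp
      then show "continuous_map (E k) T' id"
        using T' continuous_map_from_subtopology by metis
    qed (use T' in simp_all)
  qed
qed

text \<open>The universal property of the limit quantifies over topologies. The absolutely convex sets whose trace
on every step is a neighbourhood of \<open>0\<close> form the base of a locally convex topology that makes all
inclusions continuous; the limit topology is finer than this one.\<close>

lemma nbhd_strict_inductive_limit:
  assumes lim: "strict_inductive_limit s E T"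
    and V: "absolutely_convex s V" "V \<subseteq> topspace T" "\<And>n. nbhd (E n) 0 V"
  shows "nbhd T 0 V"
proof -
  have lcE: "locally_convex_space s (E n)" and lcT: "locally_convex_space s T"
    and top: "topspace T = (\<Union>n. topspace (E n))" and cont: "continuous_map (E n) T id" for n
    using lim unfolding strict_inductive_limit_def by blast+
  have fin: "continuous_map T T' id"
    if "locally_convex_space s T'" "topspace T' = topspace T" "\<And>n. continuous_map (E n) T' id" for T'
    using lim that unfolding strict_inductive_limit_def by blast
  have tE: "topological_vector_space s (E n)" and tT: "topological_vector_space s T" for n
    using lcE lcT unfolding locally_convex_space_def by blast+
  note v = topological_vector_spaceD[OF tT]
  interpret vector_space s by (rule v)
  define \<V> where "\<V> = {V. V \<subseteq> topspace T \<and> absolutely_convex s V \<and> (\<forall>n. nbhd (E n) 0 V)}"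
  have "\<exists>T'. locally_convex_space s T' \<and> topspace T' = topspace T \<and>
    (\<forall>U. openin T' U \<longleftrightarrow> U \<subseteq> topspace T \<and> (\<forall>x\<in>U. \<exists>V\<in>\<V>. \<forall>v\<in>V. x + v \<in> U)) \<and>
    (\<forall>V\<in>\<V>. nbhd T' 0 V)"
  proof (rule locally_convex_topology_exists[OF v(1,2)])
    show "\<V> \<noteq> {}" using V unfolding \<V>_def by blast
    show "V \<subseteq> topspace T" "absolutely_convex s V" if "V \<in> \<V>" for V
      using that unfolding \<V>_def by blast+
    show "V \<inter> W \<in> \<V>" if "V \<in> \<V>" "W \<in> \<V>" for V W
      using that unfolding \<V>_def by (auto intro: nbhd_Int absolutely_convex_Int)
    show "{x \<in> topspace T. s c x \<in> V} \<in> \<V>" if VV: "V \<in> \<V>" for V c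
    proof -
      have "nbhd (E n) 0 {x \<in> topspace T. s c x \<in> V}" for n
      proof (rule nbhd_mono)
        show "nbhd (E n) 0 {x \<in> topspace (E n). s c x \<in> V}"
          using VV unfolding \<V>_def by (intro nbhd_zero_scale[OF tE]) blast
        show "{x \<in> topspace (E n). s c x \<in> V} \<subseteq> {x \<in> topspace T. s c x \<in> V}"
          unfolding top by blast
      qed
      then show ?thesis
        using absolutely_convex_dilate[OF tT] VV unfolding \<V>_def by blast
    qed
    show "\<exists>\<delta>>0. \<forall>c. norm c < \<delta> \<longrightarrow> s c x \<in> V" if VV: "V \<in> \<V>" and x: "x \<in> topspace T" for V x
    proof -
      obtain n where "x \<in> topspace (E n)" using x unfolding top by blast
      then show ?thesis
        using VV unfolding \<V>_def by (intro absorbing_nbhd_zero[OF tE]) blast+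
    qed
  qed
  then obtain T' where T': "locally_convex_space s T'" "topspace T' = topspace T"
    and op: "\<forall>U. openin T' U \<longleftrightarrow> U \<subseteq> topspace T \<and> (\<forall>x\<in>U. \<exists>V\<in>\<V>. \<forall>v\<in>V. x + v \<in> U)"
    and nb: "\<forall>V\<in>\<V>. nbhd T' 0 V"
    by (elim exE conjE)
  have "continuous_map (E n) T' id" for n
    unfolding continuous_map_def
  proof (intro conjI allI impI)
    show "id \<in> topspace (E n) \<rightarrow> topspace T'" using T'(2) top by auto
    fix U assume U: "openin T' U"
    show "openin (E n) {x \<in> topspace (E n). id x \<in> U}"
      unfolding openin_iff_nbhd
    proof
      fix x assume "x \<in> {x \<in> topspace (E n). id x \<in> U}"
      then have x: "x \<in> topspace (E n)" "x \<in> U" by simp_all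
      obtain V where V: "V \<in> \<V>" "\<forall>v\<in>V. x + v \<in> U"
        using op[THEN spec, THEN iffD1, OF U, THEN conjunct2, THEN bspec, OF x(2)] by (elim bexE)
      have "nbhd (E n) 0 V" using V(1) unfolding \<V>_def by blast
      from nbhd_translation[OF tE x(1) this]
      have nx: "nbhd (E n) x {y \<in> topspace (E n). y - x \<in> V}" .
      have "id y \<in> U" if "y - x \<in> V" for y
        using V(2)[rule_format, OF that] by simp
      then show "nbhd (E n) x {x \<in> topspace (E n). id x \<in> U}"
        by (intro nbhd_mono[OF nx]) blast
    qed
  qed
  then have id: "continuous_map T T' id" by (intro fin T')
  have "V \<in> \<V>" using V unfolding \<V>_def by blast
  then have nV: "nbhd T' (id 0) V" using nb by simp
  have "{x \<in> topspace T. id x \<in> V} = V" using V(2) by auto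
  then show ?thesis using nbhd_preimage[OF id v(3) nV] by simp
qed

primrec partial_sums :: "(nat \<Rightarrow> 'a::ab_group_add set) \<Rightarrow> nat \<Rightarrow> 'a set" where
  "partial_sums W 0 = W 0"
| "partial_sums W (Suc k) = {x + y | x y. x \<in> partial_sums W k \<and> y \<in> W (Suc k)}"

lemma partial_sums_SucI:
  "x \<in> partial_sums W k \<Longrightarrow> y \<in> W (Suc k) \<Longrightarrow> x + y \<in> partial_sums W (Suc k)"
  by auto

lemma partial_sums_SucE:
  assumes "z \<in> partial_sums W (Suc k)"
  obtains x y where "z = x + y" "x \<in> partial_sums W k" "y \<in> W (Suc k)"
  using assms by auto

declare partial_sums.simps(2) [simp del]

text \<open>A sequence of absolutely convex neighbourhoods in the successive steps that is nested in the sense that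
\<open>(W (k + 1) + W (k + 1)) \<inter> E k \<subseteq> W k\<close>. The union of its partial sums is a neighbourhood of \<open>0\<close> in the
limit whose trace on each step is under control.\<close>

locale nested_nbhds =
  fixes s :: "'k::real_normed_field \<Rightarrow> 'a::ab_group_add \<Rightarrow> 'a" and E and T and W :: "nat \<Rightarrow> 'a set"
  assumes lim: "strict_inductive_limit s E T"
    and ac: "absolutely_convex s (W k)"
    and nbhd: "nbhd (E k) 0 (W k)"
    and sub: "W k \<subseteq> topspace (E k)"
    and shrink: "x \<in> W (Suc k) \<Longrightarrow> y \<in> W (Suc k) \<Longrightarrow> x + y \<in> topspace (E k) \<Longrightarrow> x + y \<in> W k"
begin

lemma tvs: "topological_vector_space s (E k)"
  using lim unfolding strict_inductive_limit_def locally_convex_space_def by blast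

lemma vs: "vector_space s"
  by (rule topological_vector_spaceD(1)[OF tvs])

lemma zero: "0 \<in> W k"
  by (rule nbhd_mem[OF nbhd])

lemma W_subset_partial_sums: "W k \<subseteq> partial_sums W k"
proof (cases k)
  case (Suc j)
  have "0 \<in> partial_sums W j" for j
  proof (induction j)
    case (Suc j)
    then have "0 + 0 \<in> partial_sums W (Suc j)" by (rule partial_sums_SucI) (rule zero)
    then show ?case by simp
  qed (simp add: zero)
  note zero_sums = this[of j]
  show ?thesis
  proof
    fix x assume "x \<in> W k"
    then have "0 + x \<in> partial_sums W k"
      using zero_sums unfolding Suc by (intro partial_sums_SucI)
    then show "x \<in> partial_sums W k" by simp
  qed
qed simp

lemma partial_sums_mono: "i \<le> j \<Longrightarrow> partial_sums W i \<subseteq> partial_sums W j"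
proof (induction j rule: dec_induct)
  case (step j)
  have "partial_sums W j \<subseteq> partial_sums W (Suc j)"
  proof
    fix x assume "x \<in> partial_sums W j"
    then have "x + 0 \<in> partial_sums W (Suc j)"
      by (rule partial_sums_SucI) (rule zero)
    then show "x \<in> partial_sums W (Suc j)" by simp
  qed
  with step.IH show ?case by (rule subset_trans)
qed simp

lemma partial_sums_subset: "partial_sums W k \<subseteq> topspace (E k)"
proof (induction k)
  case 0
  then show ?case using sub by simp
next
  case (Suc k)
  have le: "topspace (E k) \<subseteq> topspace (E (Suc k))"
    by (rule strict_inductive_limit_step[OF lim]) simp
  show ?case
  proof
    fix z assume "z \<in> partial_sums W (Suc k)"
    then obtain x y where "z = x + y" "x \<in> partial_sums W k" "y \<in> W (Suc k)"
      by (rule partial_sums_SucE)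
    moreover have "x \<in> topspace (E (Suc k))" "y \<in> topspace (E (Suc k))"
      using calculation(2,3) Suc le sub[of "Suc k"] by blast+
    ultimately show "z \<in> topspace (E (Suc k))"
      using topological_vector_spaceD(4)[OF tvs] by simp
  qed
qed

lemma absolutely_convex_partial_sums: "absolutely_convex s (partial_sums W k)"
proof (induction k)
  case 0
  then show ?case using ac by simp
next
  case (Suc k)
  interpret vector_space s by (rule vs)
  show ?case
    unfolding absolutely_convex_def
  proof (intro ballI allI impI)
    fix x y and a b :: 'k assume xy: "x \<in> partial_sums W (Suc k)" "y \<in> partial_sums W (Suc k)"
      and ab: "norm a + norm b \<le> 1"
    obtain p q where p: "x = p + q" "p \<in> partial_sums W k" "q \<in> W (Suc k)"
      using xy(1) by (rule partial_sums_SucE)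
    obtain p' q' where p': "y = p' + q'" "p' \<in> partial_sums W k" "q' \<in> W (Suc k)"
      using xy(2) by (rule partial_sums_SucE)
    have "s a x + s b y = (s a p + s b p') + (s a q + s b q')"
      using p p' by (simp add: algebra_simps)
    moreover have "s a p + s b p' \<in> partial_sums W k"
      by (rule absolutely_convexD[OF Suc p(2) p'(2) ab])
    moreover have "s a q + s b q' \<in> W (Suc k)"
      by (rule absolutely_convexD[OF ac p(3) p'(3) ab])
    ultimately show "s a x + s b y \<in> partial_sums W (Suc k)"
      using partial_sums_SucI by metis
  qed
qed

lemma nbhd_union_partial_sums: "nbhd T 0 (\<Union>k. partial_sums W k)"
proof (rule nbhd_strict_inductive_limit[OF lim])
  show "absolutely_convex s (\<Union>k. partial_sums W k)"
    unfolding absolutely_convex_def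
  proof (intro ballI allI impI)
    fix x y and a b :: 'k assume xy: "x \<in> (\<Union>k. partial_sums W k)" "y \<in> (\<Union>k. partial_sums W k)"
      and ab: "norm a + norm b \<le> 1"
    obtain i j where "x \<in> partial_sums W i" "y \<in> partial_sums W j" using xy by blast
    then have "x \<in> partial_sums W (max i j)" "y \<in> partial_sums W (max i j)"
      using partial_sums_mono[of i "max i j"] partial_sums_mono[of j "max i j"] by auto
    then have "s a x + s b y \<in> partial_sums W (max i j)"
      using absolutely_convexD[OF absolutely_convex_partial_sums _ _ ab] by blast
    then show "s a x + s b y \<in> (\<Union>k. partial_sums W k)" by blast
  qed
  show "(\<Union>k. partial_sums W k) \<subseteq> topspace T"
    using partial_sums_subset lim unfolding strict_inductive_limit_def by auto
  show "nbhd (E n) 0 (\<Union>k. partial_sums W k)" for n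
    by (rule nbhd_mono[OF nbhd]) (use W_subset_partial_sums in blast)
qed

text \<open>The collapse of the sums. The last summand and an error term, both in \<open>W (k + 1)\<close>, add up to an
element of \<open>E k\<close> whenever the total does, and then their sum lies in \<open>W k\<close>, where it is the error term
of the shorter sum.\<close>

lemma partial_sums_decompose:
  "z \<in> partial_sums W (k + j) \<Longrightarrow> z \<in> topspace (E k) \<Longrightarrow>
    \<exists>a\<in>partial_sums W k. \<exists>b\<in>W k. z = a + b"
proof (induction j arbitrary: k)
  case 0
  have "z = z + 0" by simp
  moreover have "z \<in> partial_sums W k" using 0(1) by simp
  ultimately show ?case using zero[of k] by blast
next
  case (Suc j)
  have "topspace (E k) \<subseteq> topspace (E (Suc k))"
    by (rule strict_inductive_limit_step[OF lim]) simp
  then have "z \<in> topspace (E (Suc k))" using Suc.prems(2) by blast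
  moreover have "z \<in> partial_sums W (Suc k + j)" using Suc.prems(1) by simp
  ultimately have "\<exists>a\<in>partial_sums W (Suc k). \<exists>b\<in>W (Suc k). z = a + b"
    by (intro Suc.IH)
  then obtain a b where ab: "a \<in> partial_sums W (Suc k)" "b \<in> W (Suc k)" "z = a + b"
    by (elim bexE)
  obtain a' w where a': "a = a' + w" "a' \<in> partial_sums W k" "w \<in> W (Suc k)"
    using ab(1) by (rule partial_sums_SucE)
  have "w + b = z - a'" using ab(3) a'(1) by simp
  then have "w + b \<in> topspace (E k)"
    using topological_vector_spaceD(5)[OF tvs Suc.prems(2)] partial_sums_subset a'(2) by auto
  then have "w + b \<in> W k" by (rule shrink[OF a'(3) ab(2)])
  moreover have "z = a' + (w + b)" using ab(3) a'(1) by (simp add: add.assoc)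
  ultimately show ?case using a'(2) by blast
qed

lemma union_partial_sums_decompose:
  assumes "z \<in> (\<Union>k. partial_sums W k)" "z \<in> topspace (E k)"
  shows "\<exists>a\<in>partial_sums W k. \<exists>b\<in>W k. z = a + b"
proof -
  obtain m where "z \<in> partial_sums W m" using assms(1) by blast
  then have "z \<in> partial_sums W (k + m)" using partial_sums_mono[of m "k + m"] by auto
  then show ?thesis using assms(2) by (rule partial_sums_decompose)
qed

end

text \<open>Since \<open>E k\<close> carries the subspace topology of \<open>E (k + 1)\<close>, a neighbourhood in \<open>E k\<close> is the trace of one in
\<open>E (k + 1)\<close>, so the sets can be chosen one after another. The sets \<open>M k\<close> are a further
smallness condition at the disposal of the user.\<close>

lemma nested_nbhds_exist:
  assumes lim: "strict_inductive_limit s E T" and M: "\<And>k. nbhd (E k) 0 (M k)"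
  shows "\<exists>W. nested_nbhds s E T W \<and> (\<forall>k. \<forall>x\<in>W k. \<forall>y\<in>W k. x + y \<in> M k)"
proof -
  have lc: "locally_convex_space s (E k)" for k
    using lim unfolding strict_inductive_limit_def by blast
  define P where "P k A \<longleftrightarrow> absolutely_convex s A \<and> nbhd (E k) 0 A \<and> A \<subseteq> topspace (E k) \<and>
    (\<forall>x\<in>A. \<forall>y\<in>A. x + y \<in> M k)" for k A
  define Q where "Q k A B \<longleftrightarrow> (\<forall>x\<in>B. \<forall>y\<in>B. x + y \<in> topspace (E k) \<longrightarrow> x + y \<in> A)" for k A B
  have "\<exists>W. \<forall>k. P k (W k) \<and> Q k (W k) (W (Suc k))"
  proof (rule dependent_nat_choice)
    show "\<exists>A. P 0 A"
      unfolding P_def by (rule absolutely_convex_nbhd_zero[OF lc M])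
    fix A k assume "P k A"
    then have "nbhd (E k) 0 A" unfolding P_def by blast
    then obtain U where U: "openin (E k) U" "0 \<in> U" "U \<subseteq> A"
      unfolding nbhd_def by blast
    have "E k = subtopology (E (Suc k)) (topspace (E k))"
      by (rule strict_inductive_limit_step[OF lim]) simp
    then obtain N where N: "openin (E (Suc k)) N" "U = N \<inter> topspace (E k)"
      using U(1) openin_subtopology by metis
    have "0 \<in> N" using U(2) N(2) by blast
    from absolutely_convex_nbhd_zero[OF lc nbhd_Int[OF nbhd_openin[OF N(1) this] M]]
    obtain B where B: "absolutely_convex s B" "nbhd (E (Suc k)) 0 B" "B \<subseteq> topspace (E (Suc k))"
      "\<forall>x\<in>B. \<forall>y\<in>B. x + y \<in> N \<inter> M (Suc k)"
      by (elim exE conjE)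
    then have "P (Suc k) B" unfolding P_def by simp
    moreover have "Q k A B"
      unfolding Q_def using B(4) N(2) U(3) by blast
    ultimately show "\<exists>B. P (Suc k) B \<and> Q k A B" by blast
  qed
  then obtain W where W: "\<And>k. P k (W k)" "\<And>k. Q k (W k) (W (Suc k))" by blast
  have "nested_nbhds s E T W"
  proof
    show "strict_inductive_limit s E T" by fact
    show "absolutely_convex s (W k)" "nbhd (E k) 0 (W k)" "W k \<subseteq> topspace (E k)" for k
      using W(1)[of k] unfolding P_def by blast+
    show "x + y \<in> W k" if "x \<in> W (Suc k)" "y \<in> W (Suc k)" "x + y \<in> topspace (E k)" for x y k
      using W(2)[of k] that unfolding Q_def by blast
  qed
  moreover have "\<forall>k. \<forall>x\<in>W k. \<forall>y\<in>W k. x + y \<in> M k"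
    using W(1) unfolding P_def by blast
  ultimately show ?thesis by blast
qed

text \<open>After a shift the step is the first one, and then the trace of the union of sums on it is
contained in \<open>W 0 + W 0\<close>, which can be made as small as required.\<close>

lemma strict_inductive_limit_induces:
  assumes lim: "strict_inductive_limit s E T" and U: "nbhd (E n) 0 U"
  shows "\<exists>V. nbhd T 0 V \<and> V \<inter> topspace (E n) \<subseteq> U"
proof -
  let ?E = "\<lambda>k. E (n + k)"
  define M where "M k = (if k = 0 then U else topspace (?E k))" for k
  have tv: "topological_vector_space s (E k)" for k
    using lim unfolding strict_inductive_limit_def locally_convex_space_def by blast
  have "nbhd (?E k) 0 (M k)" for k
    using U nbhd_zero_topspace[OF tv] by (simp add: M_def)
  from nested_nbhds_exist[OF strict_inductive_limit_shift[OF lim] this]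
  obtain W where W: "nested_nbhds s ?E T W" and WM: "\<forall>k. \<forall>x\<in>W k. \<forall>y\<in>W k. x + y \<in> M k"
    by (elim exE conjE)
  interpret nested_nbhds s ?E T W by (rule W)
  have "z \<in> U" if z: "z \<in> (\<Union>k. partial_sums W k)" "z \<in> topspace (E n)" for z
  proof -
    obtain a b where "a \<in> W 0" "b \<in> W 0" "z = a + b"
      using union_partial_sums_decompose[OF z(1), of 0] z(2) by auto
    then show ?thesis using WM[rule_format, of a 0 b] by (simp add: M_def)
  qed
  then show ?thesis using nbhd_union_partial_sums by blast
qed

section \<open>Bounded sets of a strict (LF)-space\<close>

text \<open>A limit in the larger space of a sequence in the smaller one: the sequence is Cauchy for the
invariant metric of the smaller space, as the differences tend to \<open>0\<close> in the common topology, so by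
completeness it already has a limit there, and limits in the larger space are unique.\<close>

lemma frechet_step_closed:
  assumes F: "frechet_space s E" "frechet_space s G"
    and E: "topspace E \<subseteq> topspace G" "E = subtopology G (topspace E)"
  shows "closedin G (topspace E)"
proof -
  obtain d where d: "Metric_space (topspace E) d" "Metric_space.mtopology (topspace E) d = E"
      "Metric_space.mcomplete (topspace E) d"
      "\<forall>x\<in>topspace E. \<forall>y\<in>topspace E. \<forall>z\<in>topspace E. d (x + z) (y + z) = d x y"
    using F(1) unfolding frechet_space_def by blast
  obtain e where e: "Metric_space (topspace G) e" "Metric_space.mtopology (topspace G) e = G"
      "\<forall>x\<in>topspace G. \<forall>y\<in>topspace G. \<forall>z\<in>topspace G. e (x + z) (y + z) = e x y"
    using F(2) unfolding frechet_space_def by blast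
  have tE: "topological_vector_space s E" and tG: "topological_vector_space s G"
    using F unfolding frechet_space_def locally_convex_space_def by blast+
  note vE = topological_vector_spaceD[OF tE] and vG = topological_vector_spaceD[OF tG]
  interpret D: Metric_space "topspace E" d by fact
  interpret M: Metric_space "topspace G" e by fact
  have "closedin M.mtopology (topspace E)"
    unfolding M.metric_closedin_iff_sequentially_closed
  proof (intro conjI allI impI)
    show "topspace E \<subseteq> topspace G" by fact
    fix \<sigma> l assume "range \<sigma> \<subseteq> topspace E \<and> limitin M.mtopology \<sigma> l sequentially"
    then have \<sigma>: "\<And>n. \<sigma> n \<in> topspace E" and lim: "limitin M.mtopology \<sigma> l sequentially" by auto
    have l: "l \<in> topspace G" using lim M.limitin_mspace by blast
    have "D.MCauchy \<sigma>"
      unfolding D.MCauchy_def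
    proof (intro conjI allI impI)
      show "range \<sigma> \<subseteq> topspace E" using \<sigma> by blast
      fix r :: real assume r: "r > 0"
      have "openin E (D.mball 0 r)"
        using D.openin_mball d(2) by metis
      then obtain U where U: "openin G U" "D.mball 0 r = U \<inter> topspace E"
        using E(2) openin_subtopology by metis
      have "0 \<in> U" using U(2) r vE(3) D.centre_in_mball_iff by blast
      then obtain p where p: "p > 0" "M.mball 0 p \<subseteq> U"
        using U(1) M.openin_mtopology[of U] e(2) by auto
      obtain K where K: "\<And>n. n \<ge> K \<Longrightarrow> e (\<sigma> n) l < p / 2"
        using lim p(1) unfolding M.limit_metric_sequentially by (meson half_gt_zero)
      have "d (\<sigma> n) (\<sigma> m) < r" if "K \<le> n" "K \<le> m" for n m
      proof -
        have G: "\<sigma> n \<in> topspace G" "\<sigma> m \<in> topspace G" using \<sigma> E(1) by blast+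
        have "e (\<sigma> n) (\<sigma> m) \<le> e (\<sigma> n) l + e l (\<sigma> m)"
          using M.triangle G l by blast
        then have "e (\<sigma> n) (\<sigma> m) < p"
          using K[OF that(1)] K[OF that(2)] M.commute[of "\<sigma> m" l] by linarith
        moreover have "e (0 + \<sigma> m) (\<sigma> n - \<sigma> m + \<sigma> m) = e 0 (\<sigma> n - \<sigma> m)"
          using e(3) vG G by blast
        ultimately have "\<sigma> n - \<sigma> m \<in> M.mball 0 p"
          using vG G by (simp add: M.commute)
        then have "\<sigma> n - \<sigma> m \<in> D.mball 0 r"
          using p(2) U(2) vE(5)[OF \<sigma> \<sigma>] by blast
        moreover have "d (0 + \<sigma> m) (\<sigma> n - \<sigma> m + \<sigma> m) = d 0 (\<sigma> n - \<sigma> m)"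
          using d(4) vE \<sigma> by blast
        ultimately show ?thesis by (simp add: D.commute)
      qed
      then show "\<exists>N. \<forall>n n'. N \<le> n \<longrightarrow> N \<le> n' \<longrightarrow> d (\<sigma> n) (\<sigma> n') < r" by blast
    qed
    then obtain a where a: "limitin E \<sigma> a sequentially"
      using d(2,3) D.mcomplete_def by metis
    then have "limitin G \<sigma> a sequentially"
      using E(2) limitin_subtopology by metis
    then have "a = l"
      using M.limitin_metric_unique[of \<sigma> a sequentially l] lim e(2) by simp
    then show "l \<in> topspace E" using limitin_topspace[OF a] by simp
  qed
  then show ?thesis using e(2) by simp
qed

text \<open>If \<open>B\<close> is in no step, then for infinitely many \<open>j\<close> there is \<open>x j \<in> B\<close> in \<open>E (j + 1)\<close> but not in
\<open>E j\<close>. Closedness of \<open>E j\<close> in \<open>E (j + 1)\<close> permits a choice of \<open>W (j + 1)\<close> such that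
\<open>y j = x j / (j + 1)\<close> is not in \<open>E j + W (j + 1) + W (j + 1)\<close>. The collapse of sums
then shows that the neighbourhood \<open>V\<close> of \<open>0\<close> in the limit contains no \<open>y j\<close>, that is,
\<open>x j \<notin> (j + 1) V\<close> for infinitely many \<open>j\<close>, which contradicts boundedness.\<close>

lemma bounded_subset_step:
  fixes s :: "'k::real_normed_field \<Rightarrow> 'a::ab_group_add \<Rightarrow> 'a"
  assumes lim: "strict_inductive_limit s E T" and B: "tvs_bounded s T B"
    and closed: "\<And>k. closedin (E (Suc k)) (topspace (E k))"
  shows "\<exists>n. B \<subseteq> topspace (E n)"
proof (rule ccontr)
  assume no: "\<nexists>n. B \<subseteq> topspace (E n)"
  let ?X = "\<lambda>k. topspace (E k)"
  note step = strict_inductive_limit_step[OF lim]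
  have tv: "topological_vector_space s (E k)" for k
    using lim unfolding strict_inductive_limit_def locally_convex_space_def by blast
  interpret vector_space s by (rule topological_vector_spaceD[OF tv])
  have unbounded: "\<exists>j\<ge>m. \<exists>x. x \<in> B \<and> x \<in> ?X (Suc j) \<and> x \<notin> ?X j" for m
  proof (rule ccontr)
    assume no': "\<not> ?thesis"
    have "x \<in> ?X m" if x: "x \<in> B" "x \<in> ?X i" for x i
      using x(2)
    proof (induction i)
      case 0
      then show ?case using step(1)[of 0 m] by auto
    next
      case (Suc i)
      show ?case
      proof (cases "m \<le> i")
        case True
        then have "x \<in> ?X i" using no' x(1) Suc.prems by blast
        then show ?thesis by (rule Suc.IH)
      next
        case False
        then have "?X (Suc i) \<subseteq> ?X m" by (intro step) simp
        then show ?thesis using Suc.prems by blast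
      qed
    qed
    moreover have "B \<subseteq> (\<Union>i. ?X i)"
      using B lim unfolding tvs_bounded_def strict_inductive_limit_def by blast
    ultimately have "B \<subseteq> ?X m" by blast
    then show False using no by blast
  qed
  define K where "K = {j. \<exists>x. x \<in> B \<and> x \<in> ?X (Suc j) \<and> x \<notin> ?X j}"
  have "\<forall>j. \<exists>x. j \<in> K \<longrightarrow> x \<in> B \<and> x \<in> ?X (Suc j) \<and> x \<notin> ?X j"
    unfolding K_def by blast
  from choice[OF this] obtain x where x: "\<And>j. j \<in> K \<Longrightarrow> x j \<in> B"
      "\<And>j. j \<in> K \<Longrightarrow> x j \<in> ?X (Suc j)" "\<And>j. j \<in> K \<Longrightarrow> x j \<notin> ?X j"
    by blast
  define y where "y j = s (inverse (of_nat (Suc j))) (x j)" for j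
  have xy: "x j = s (of_nat (Suc j)) (y j)" for j
    unfolding y_def by (simp del: of_nat_Suc)
  have y: "y j \<in> ?X (Suc j)" "y j \<notin> ?X j" if j: "j \<in> K" for j
  proof -
    show "y j \<in> ?X (Suc j)" unfolding y_def
      by (rule topological_vector_spaceD(6)[OF tv x(2)[OF j]])
    show "y j \<notin> ?X j" using topological_vector_spaceD(6)[OF tv] x(3)[OF j] xy[of j] by metis
  qed
  \<comment> \<open>For \<open>m \<in> M (j + 1)\<close> with \<open>j \<in> K\<close> the point \<open>y j - m\<close> is not in \<open>E j\<close>.\<close>
  define M where "M k = (if k > 0 \<and> k - 1 \<in> K
    then {m \<in> ?X k. y (k - 1) + s (- 1) m \<in> ?X k - ?X (k - 1)} else ?X k)" for k
  have M: "nbhd (E k) 0 (M k)" for k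
  proof (cases "k > 0 \<and> k - 1 \<in> K")
    case False
    then have "M k = ?X k" unfolding M_def by (simp only: if_False)
    then show ?thesis using nbhd_zero_topspace[OF tv] by simp
  next
    case True
    then obtain j where j: "k = Suc j" "j \<in> K" by (cases k) auto
    have "continuous_map (E k) (E k) ((\<lambda>m. y j + m) \<circ> s (- 1))"
      by (rule continuous_map_compose[OF continuous_map_scale[OF tv] continuous_map_translation[OF tv]])
        (use y(1)[OF j(2)] j(1) in simp)
    moreover have "0 \<in> ?X k" by (rule topological_vector_spaceD[OF tv])
    moreover have "nbhd (E k) (((\<lambda>m. y j + m) \<circ> s (- 1)) 0) (?X k - ?X j)"
      using y[OF j(2)] closed[of j] j(1) by (intro nbhd_openin) (auto intro: openin_diff)
    ultimately have "nbhd (E k) 0 {m \<in> ?X k. ((\<lambda>m. y j + m) \<circ> s (- 1)) m \<in> ?X k - ?X j}"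
      by (rule nbhd_preimage)
    moreover have "M k = {m \<in> ?X k. ((\<lambda>m. y j + m) \<circ> s (- 1)) m \<in> ?X k - ?X j}"
      using j unfolding M_def by simp
    ultimately show ?thesis by simp
  qed
  from nested_nbhds_exist[OF lim M]
  obtain W where W: "nested_nbhds s E T W" and WM: "\<forall>k. \<forall>x\<in>W k. \<forall>y\<in>W k. x + y \<in> M k"
    by (elim exE conjE)
  interpret nested_nbhds s E T W by (rule W)
  have avoid: "y j \<notin> (\<Union>k. partial_sums W k)" if j: "j \<in> K" for j
  proof
    assume "y j \<in> (\<Union>k. partial_sums W k)"
    then obtain a b where ab: "a \<in> partial_sums W (Suc j)" "b \<in> W (Suc j)" "y j = a + b"
      using union_partial_sums_decompose[OF _ y(1)[OF j]] by blast
    obtain a' w where a': "a = a' + w" "a' \<in> partial_sums W j" "w \<in> W (Suc j)"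
      using ab(1) by (rule partial_sums_SucE)
    have "w + b \<in> M (Suc j)" using WM a'(3) ab(2) by blast
    then have "y j + s (- 1) (w + b) \<notin> ?X j" using j unfolding M_def by (simp add: algebra_simps)
    moreover have "y j + s (- 1) (w + b) = a'" using ab(3) a'(1) by simp
    ultimately show False using partial_sums_subset a'(2) by auto
  qed
  obtain r where r: "r > 0" "\<forall>c. norm c \<ge> r \<longrightarrow> B \<subseteq> s c ` (\<Union>k. partial_sums W k)"
    using tvs_boundedD[OF B nbhd_union_partial_sums] by blast
  obtain m where m: "r \<le> real m" using real_arch_simple by blast
  obtain j where j: "j \<ge> m" "j \<in> K" using unbounded[of m] unfolding K_def by blast
  have "r \<le> norm (of_nat (Suc j) :: 'k)" using m j(1) unfolding norm_of_nat by simp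
  then have "x j \<in> s (of_nat (Suc j)) ` (\<Union>k. partial_sums W k)"
    using r(2) x(1)[OF j(2)] by blast
  then obtain v where v: "v \<in> (\<Union>k. partial_sums W k)" "x j = s (of_nat (Suc j)) v" by blast
  have "v = y j" using v(2) unfolding y_def by (simp del: of_nat_Suc)
  then show False using avoid[OF j(2)] v(1) by simp
qed

lemma tvs_bounded_step:
  assumes lim: "strict_inductive_limit s E T" and B: "tvs_bounded s T B" "B \<subseteq> topspace (E n)"
  shows "tvs_bounded s (E n) B"
  unfolding tvs_bounded_def
proof (intro conjI allI impI B(2))
  have tv: "topological_vector_space s (E k)" for k
    using lim unfolding strict_inductive_limit_def locally_convex_space_def by blast
  interpret vector_space s by (rule topological_vector_spaceD[OF tv])
  fix U assume "openin (E n) U \<and> 0 \<in> U"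
  then have "nbhd (E n) 0 U" by (intro nbhd_openin) simp_all
  then obtain V where V: "nbhd T 0 V" "V \<inter> topspace (E n) \<subseteq> U"
    using strict_inductive_limit_induces[OF lim] by blast
  obtain r where r: "r > 0" "\<forall>c. norm c \<ge> r \<longrightarrow> B \<subseteq> s c ` V"
    using tvs_boundedD[OF B(1) V(1)] by blast
  have "B \<subseteq> s c ` U" if c: "r \<le> norm c" for c
  proof
    fix b assume b: "b \<in> B"
    then obtain v where v: "v \<in> V" "b = s c v" using r(2) c by blast
    have "c \<noteq> 0" using c r(1) by auto
    then have "v = s (inverse c) b" using v(2) by simp
    then have "v \<in> topspace (E n)" using topological_vector_spaceD(6)[OF tv] B(2) b by blast
    then show "b \<in> s c ` U" using v V(2) by blast
  qed
  then show "\<exists>r>0. \<forall>c. norm c \<ge> r \<longrightarrow> B \<subseteq> s c ` U" using r(1) by blast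
qed

lemma tvs_bounded_limit:
  assumes lim: "strict_inductive_limit s E T" and B: "tvs_bounded s (E n) B"
  shows "tvs_bounded s T B"
  unfolding tvs_bounded_def
proof (intro conjI allI impI)
  have tv: "topological_vector_space s (E n)" and top: "topspace T = (\<Union>n. topspace (E n))"
    and cont: "continuous_map (E n) T id"
    using lim unfolding strict_inductive_limit_def locally_convex_space_def by blast+
  show "B \<subseteq> topspace T" using B top unfolding tvs_bounded_def by blast
  fix U assume "openin T U \<and> 0 \<in> U"
  then have "nbhd T (id 0) U" by (intro nbhd_openin) simp_all
  then have "nbhd (E n) 0 {x \<in> topspace (E n). id x \<in> U}"
    by (rule nbhd_preimage[OF cont topological_vector_spaceD(3)[OF tv]])
  then have "nbhd (E n) 0 U" by (rule nbhd_mono) auto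
  then show "\<exists>r>0. \<forall>c. norm c \<ge> r \<longrightarrow> B \<subseteq> s c ` U" by (rule tvs_boundedD[OF B])
qed

lemma frechet_space_countable_base:
  assumes "frechet_space s E"
  shows "\<exists>U. (\<forall>i::nat. nbhd E 0 (U i)) \<and> (\<forall>N. nbhd E 0 N \<longrightarrow> (\<exists>i. U i \<subseteq> N))"
proof -
  obtain d where d: "Metric_space (topspace E) d" "Metric_space.mtopology (topspace E) d = E"
    using assms unfolding frechet_space_def by (elim conjE exE)
  have tv: "topological_vector_space s E"
    using assms unfolding frechet_space_def locally_convex_space_def by blast
  interpret Metric_space "topspace E" d by fact
  have zero: "0 \<in> topspace E" by (rule topological_vector_spaceD(3)[OF tv])
  show ?thesis
  proof (intro exI[of _ "\<lambda>i. mball 0 (inverse (real (Suc i)))"] conjI allI impI)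
    show "nbhd E 0 (mball 0 (inverse (real (Suc i))))" for i
    proof (rule nbhd_openin)
      show "openin E (mball 0 (inverse (real (Suc i))))"
        using openin_mball[of 0 "inverse (real (Suc i))"] d(2) by simp
      show "0 \<in> mball 0 (inverse (real (Suc i)))"
        using zero by simp
    qed
    fix N assume "nbhd E 0 N"
    then obtain O' where O': "openin E O'" "0 \<in> O'" "O' \<subseteq> N" unfolding nbhd_def by blast
    have "openin mtopology O'" using O'(1) d(2) by simp
    then obtain r where r: "r > 0" "mball 0 r \<subseteq> O'"
      using O'(2) unfolding openin_mtopology by blast
    obtain i where "inverse (real (Suc i)) < r" using reals_Archimedean[OF r(1)] by blast
    then have "mball 0 (inverse (real (Suc i))) \<subseteq> mball 0 r"
      by (intro mball_subset_concentric) simp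
    then show "\<exists>i. mball 0 (inverse (real (Suc i))) \<subseteq> N" using r(2) O'(3) by blast
  qed
qed

text \<open>The intersection of the multiples \<open>\<alpha> i \<cdot> U i\<close> in disguise: asking for all scalars of norm at least
\<open>\<alpha> i + 1\<close> makes the set behave as if the \<open>U i\<close> were balanced.\<close>

definition bounded_box ::
  "('k::real_normed_field \<Rightarrow> 'a::ab_group_add \<Rightarrow> 'a) \<Rightarrow> 'a topology \<Rightarrow> (nat \<Rightarrow> 'a set) \<Rightarrow> (nat \<Rightarrow> nat) \<Rightarrow> 'a set"
  where "bounded_box s E U \<alpha> =
    {x \<in> topspace E. \<forall>i c. norm c \<ge> real (Suc (\<alpha> i)) \<longrightarrow> x \<in> s c ` U i}"

lemma bounded_box_mono:
  assumes "\<alpha> \<le> \<beta>"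
  shows "bounded_box s E U \<alpha> \<subseteq> bounded_box s E U \<beta>"
proof -
  have "real (Suc (\<alpha> i)) \<le> real (Suc (\<beta> i))" for i
    using le_funD[OF assms, of i] by simp
  then show ?thesis unfolding bounded_box_def using order_trans by blast
qed

lemma tvs_bounded_bounded_box:
  assumes base: "\<And>N. nbhd E 0 N \<Longrightarrow> \<exists>i. U i \<subseteq> N"
  shows "tvs_bounded s E (bounded_box s E U \<alpha>)"
  unfolding tvs_bounded_def
proof (intro conjI allI impI)
  show "bounded_box s E U \<alpha> \<subseteq> topspace E" unfolding bounded_box_def by blast
  fix O' assume "openin E O' \<and> 0 \<in> O'"
  then have "nbhd E 0 O'" by (intro nbhd_openin) simp_all
  then obtain i where i: "U i \<subseteq> O'" using base by blast
  have "bounded_box s E U \<alpha> \<subseteq> s c ` O'" if "real (Suc (\<alpha> i)) \<le> norm c" for c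
    using that i unfolding bounded_box_def by blast
  then show "\<exists>r>0. \<forall>c. r \<le> norm c \<longrightarrow> bounded_box s E U \<alpha> \<subseteq> s c ` O'"
    by (intro exI[of _ "real (Suc (\<alpha> i))"]) simp
qed

lemma tvs_bounded_subset_bounded_box:
  fixes s :: "'k::real_normed_field \<Rightarrow> 'a::ab_group_add \<Rightarrow> 'a"
  assumes U: "\<And>i. nbhd E 0 (U i)" and C: "tvs_bounded s E C"
  shows "\<exists>\<alpha>. C \<subseteq> bounded_box s E U \<alpha>"
proof -
  have "\<exists>n. \<forall>c. norm c \<ge> real (Suc n) \<longrightarrow> C \<subseteq> s c ` U i" for i
  proof -
    obtain r where r: "r > 0" "\<forall>c. norm c \<ge> r \<longrightarrow> C \<subseteq> s c ` U i"
      using tvs_boundedD[OF C U] by blast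
    obtain n where "r \<le> real n" using real_arch_simple by blast
    then have "r \<le> norm c" if "real (Suc n) \<le> norm c" for c :: 'k
      using that by simp
    then show ?thesis using r(2) by blast
  qed
  then have "\<forall>i. \<exists>n. \<forall>c. norm c \<ge> real (Suc n) \<longrightarrow> C \<subseteq> s c ` U i" by blast
  from choice[OF this] obtain \<alpha> where
    \<alpha>: "\<forall>i c. norm c \<ge> real (Suc (\<alpha> i)) \<longrightarrow> C \<subseteq> s c ` U i" by blast
  have "C \<subseteq> topspace E" using C unfolding tvs_bounded_def by blast
  then show ?thesis using \<alpha> unfolding bounded_box_def by (intro exI[of _ \<alpha>]) blast
qed

text \<open>The coordinate \<open>\<alpha> 0\<close> is a bound for the number of the step and the other coordinates give the size
in that step. The union over all steps up to \<open>\<alpha> 0\<close>, rather than step \<open>\<alpha> 0\<close> alone, makes the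
family increasing in \<open>\<alpha>\<close>, because the sizes in different steps refer to unrelated bases.\<close>

lemma strict_LF_bounded_sets:
  fixes s :: "'k::real_normed_field \<Rightarrow> 'a::ab_group_add \<Rightarrow> 'a"
  assumes "strict_LF_space s T"
  shows "\<exists>B :: (nat \<Rightarrow> nat) \<Rightarrow> 'a set. (\<forall>\<alpha>. tvs_bounded s T (B \<alpha>)) \<and>
    (\<forall>\<alpha> \<beta>. \<alpha> \<le> \<beta> \<longrightarrow> B \<alpha> \<subseteq> B \<beta>) \<and> (\<forall>C. tvs_bounded s T C \<longrightarrow> (\<exists>\<alpha>. C \<subseteq> B \<alpha>))"
proof -
  obtain E where E: "\<And>n. frechet_space s (E n)" and lim: "strict_inductive_limit s E T"
    using assms unfolding strict_LF_space_def by blast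
  have "\<forall>n. \<exists>U. (\<forall>i::nat. nbhd (E n) 0 (U i)) \<and> (\<forall>N. nbhd (E n) 0 N \<longrightarrow> (\<exists>i. U i \<subseteq> N))"
    by (intro allI frechet_space_countable_base[OF E])
  from choice[OF this] obtain U where U: "\<And>n i::nat. nbhd (E n) 0 (U n i)"
      and base: "\<And>n N. nbhd (E n) 0 N \<Longrightarrow> \<exists>i. U n i \<subseteq> N"
    by blast
  define K where "K n = bounded_box s (E n) (U n)" for n
  define B where "B \<alpha> = (\<Union>n\<in>{..\<alpha> 0}. K n (\<lambda>i. \<alpha> (Suc i)))" for \<alpha> :: "nat \<Rightarrow> nat"
  have K_bounded: "tvs_bounded s (E n) (K n \<alpha>)" for n \<alpha>
    unfolding K_def by (rule tvs_bounded_bounded_box[OF base])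
  have "tvs_bounded s T (B \<alpha>)" for \<alpha>
    unfolding B_def by (rule tvs_bounded_UN[OF finite_atMost tvs_bounded_limit[OF lim K_bounded]])
  moreover have "B \<alpha> \<subseteq> B \<beta>" if le: "\<alpha> \<le> \<beta>" for \<alpha> \<beta>
    unfolding B_def
  proof (rule UN_mono)
    show "{..\<alpha> 0} \<subseteq> {..\<beta> 0}" using le_funD[OF le] by simp
    have "(\<lambda>i. \<alpha> (Suc i)) \<le> (\<lambda>i. \<beta> (Suc i))"
      using le by (simp add: le_fun_def)
    then show "K n (\<lambda>i. \<alpha> (Suc i)) \<subseteq> K n (\<lambda>i. \<beta> (Suc i))" for n
      unfolding K_def by (rule bounded_box_mono)
  qed
  moreover have "\<exists>\<alpha>. C \<subseteq> B \<alpha>" if C: "tvs_bounded s T C" for C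
  proof -
    have "closedin (E (Suc k)) (topspace (E k))" for k
      by (rule frechet_step_closed[OF E E]) (rule strict_inductive_limit_step[OF lim]; simp)+
    then obtain n where n: "C \<subseteq> topspace (E n)" using bounded_subset_step[OF lim C] by blast
    have "\<exists>\<beta>. C \<subseteq> K n \<beta>"
      unfolding K_def by (rule tvs_bounded_subset_bounded_box[OF U tvs_bounded_step[OF lim C n]])
    then obtain \<beta> where \<beta>: "C \<subseteq> K n \<beta>" by (rule exE)
    have "C \<subseteq> B (case_nat n \<beta>)" unfolding B_def using \<beta> by auto
    then show ?thesis by blast
  qed
  ultimately show ?thesis by blast
qed

section \<open>Fan tightness and metrizability of the strong dual\<close>

theorem corollary2p6:
  fixes s :: "'k::real_normed_field \<Rightarrow> 'a::ab_group_add \<Rightarrow> 'a"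
    and E :: "'a topology"
  assumes "strict_LF_space s E"
  shows "countable_fan_tightness (strong_dual s E) \<longleftrightarrow> metrizable_space (strong_dual s E)"
proof
  assume "metrizable_space (strong_dual s E)"
  then show "countable_fan_tightness (strong_dual s E)"
    by (intro first_countable_imp_countable_fan_tightness metrizable_imp_first_countable)
next
  assume fan: "countable_fan_tightness (strong_dual s E)"
  let ?F = "strong_dual s E"
  let ?z = "restrict (\<lambda>x. 0) (topspace E) :: 'a \<Rightarrow> 'k"
  have tv: "topological_vector_space s E"
    using assms unfolding strict_LF_space_def strict_inductive_limit_def locally_convex_space_def by blast
  note vs = topological_vector_spaceD(1)[OF tv] and sub = topological_vector_spaceD(2)[OF tv]
  have z: "?z \<in> topological_dual s E" by (rule topological_dual_zero[OF sub vs])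
  obtain B :: "(nat \<Rightarrow> nat) \<Rightarrow> 'a set" where bounded: "\<forall>\<alpha>. tvs_bounded s E (B \<alpha>)"
    and mono: "\<forall>\<alpha> \<beta>. \<alpha> \<le> \<beta> \<longrightarrow> B \<alpha> \<subseteq> B \<beta>"
    and cofinal: "\<forall>C. tvs_bounded s E C \<longrightarrow> (\<exists>\<alpha>. C \<subseteq> B \<alpha>)"
    using strict_LF_bounded_sets[OF assms] by (elim exE conjE)
  \<comment> \<open>Coordinate \<open>0\<close> codes the radius, the remaining ones the bounded set.\<close>
  define N where "N \<alpha> = {g \<in> topological_dual s E.
      \<forall>x\<in>B (\<lambda>i. \<alpha> (Suc i)). norm (g x - ?z x) \<le> inverse (real (Suc (\<alpha> 0)))}" for \<alpha> :: "nat \<Rightarrow> nat"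
  have "\<exists>\<B>. countable \<B> \<and> (\<forall>V\<in>\<B>. nbhd ?F ?z V) \<and>
      (\<forall>U. openin ?F U \<and> ?z \<in> U \<longrightarrow> (\<exists>V\<in>\<B>. V \<subseteq> U))"
  proof (rule countable_fan_tightness_imp_countable_base[OF fan])
    show "?z \<in> topspace ?F" using z by (simp add: topspace_strong_dual)
    show "nbhd ?F ?z (N \<alpha>)" for \<alpha>
      unfolding nbhd_strong_dual[OF z] N_def
      using bounded by (intro exI[of _ "B (\<lambda>i. \<alpha> (Suc i))"] exI[of _ "inverse (real (Suc (\<alpha> 0)))"]) simp
    show "N \<beta> \<subseteq> N \<alpha>" if "\<alpha> \<le> \<beta>" for \<alpha> \<beta>
    proof -
      have "B (\<lambda>i. \<alpha> (Suc i)) \<subseteq> B (\<lambda>i. \<beta> (Suc i))"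
        using mono le_funD[OF that] by (simp add: le_fun_def)
      moreover have "inverse (real (Suc (\<beta> 0))) \<le> inverse (real (Suc (\<alpha> 0)))"
        using le_funD[OF that, of 0] by (intro le_imp_inverse_le) simp_all
      ultimately show ?thesis unfolding N_def using order_trans by blast
    qed
    show "\<exists>\<alpha>. N \<alpha> \<subseteq> U" if U: "openin ?F U" "?z \<in> U" for U
    proof -
      obtain C e where C: "tvs_bounded s E C" "e > 0"
        "{g \<in> topological_dual s E. \<forall>x\<in>C. norm (g x - ?z x) \<le> e} \<subseteq> U"
        using nbhd_openin[OF U] unfolding nbhd_strong_dual[OF z] by blast
      obtain \<beta> where \<beta>: "C \<subseteq> B \<beta>" using cofinal C(1) by blast
      obtain m where m: "inverse (real (Suc m)) < e" using reals_Archimedean[OF C(2)] by blast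
      have "N (case_nat m \<beta>) \<subseteq> {g \<in> topological_dual s E. \<forall>x\<in>C. norm (g x - ?z x) \<le> e}"
      proof
        fix g assume g: "g \<in> N (case_nat m \<beta>)"
        have "norm (g x - ?z x) \<le> e" if "x \<in> C" for x
        proof -
          have "norm (g x - ?z x) \<le> inverse (real (Suc m))"
            using g subsetD[OF \<beta> that] unfolding N_def by (simp only: mem_Collect_eq nat.case)
          then show ?thesis using m by linarith
        qed
        then show "g \<in> {g \<in> topological_dual s E. \<forall>x\<in>C. norm (g x - ?z x) \<le> e}"
          using g unfolding N_def by blast
      qed
      then show ?thesis using C(3) by blast
    qed
  qed
  then obtain \<B> where "countable \<B>" "\<forall>V\<in>\<B>. nbhd ?F ?z V"
      "\<forall>U. openin ?F U \<and> ?z \<in> U \<longrightarrow> (\<exists>V\<in>\<B>. V \<subseteq> U)"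
    by (elim exE conjE)
  then show "metrizable_space ?F"
    by (intro metrizable_strong_dual[OF sub vs tvs_bounded_singleton[OF tv], of \<B>]) simp_all
qed

end
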